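(* Suppose $\beta\ge1+C_F^2$. Let $f\in L^2(\Omega)$, $g\in H_0^1(\Omega)$, and let $\boldsymbol{u}=(u,\boldsymbol{\sigma},\lambda)\in K^1$ denote the solution of $$c_\beta(\boldsymbol{u},\boldsymbol{v}-\boldsymbol{u})\ge H_\beta(\boldsymbol{v}-\boldsymbol{u})\quad\text{for all }\boldsymbol{v}\in K^1 .$$ Let $K_h\subset U$ be a non-empty convex and closed subset and let $\boldsymbol{u}_h=(u_h,\boldsymbol{\sigma}_h,\lambda_h)\in K_h$ denote the solution of $$c_\beta(\boldsymbol{u}_h,\boldsymbol{v}_h-\boldsymbol{u}_h)\ge H_\beta(\boldsymbol{v}_h-\boldsymbol{u}_h)\quad\text{for all }\boldsymbol{v}_h\in K_h .$$ Then, with a constant $C_{\mathrm{opt}}>0$ depending only on $\beta$ and $\Omega$, $$\|\boldsymbol{u}-\boldsymbol{u}_h\|_U^2\le C_{\mathrm{opt}}\Big(\inf_{\boldsymbol{v}_h\in K_h}\big(\|\boldsymbol{u}-\boldsymbol{v}_h\|_U^2+|\langle\mu_h-\lambda,u-g\rangle|\big)+\inf_{\boldsymbol{v}\in K^1}|\langle\mu-\lambda_h,u-g\rangle|\Big),$$ where $\boldsymbol{v}_h=(v_h,\boldsymbol{\tau}_h,\mu_h)$ and $\boldsymbol{v}=(v,\boldsymbol{\tau},\mu)$.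
   Context: $\Omega\subset\mathbb{R}^n$, $n\in\{2,3\}$, is a polygonal (polyhedral) bounded Lipschitz domain. $(\cdot,\cdot)$ and $\|\cdot\|$ are the $L^2(\Omega)$ (or $L^2(\Omega)^n$) inner product and norm. $H^{-1}(\Omega)$ is the dual of $H_0^1(\Omega)$, with duality $\langle\cdot,\cdot\rangle$ extending the $L^2(\Omega)$ inner product. The generalized divergence $\operatorname{div}:L^2(\Omega)^n\to H^{-1}(\Omega)$ is $\langle\operatorname{div}\boldsymbol{\sigma},v\rangle:=-(\boldsymbol{\sigma},\nabla v)$ for $v\in H_0^1(\Omega)$. $C_F=C_F(\Omega)$, $0<C_F\le\operatorname{diam}(\Omega)$, is the constant in Friedrichs' inequality $\|v\|\le C_F\|\nabla v\|$ for all $v\in H_0^1(\Omega)$. For $v\in H^1(\Omega)$, $v\ge0$ means $v\ge 0$ a.e. in $\Omega$; for $\lambda\in H^{-1}(\Omega)$, $\lambda\ge0$ means $\langle\lambda,v\rangle\ge0$ for all $v\in H_0^1(\Omega)$ with $v\ge0$. $U:=\{(u,\boldsymbol{\sigma},\lambda)\in H_0^1(\Omega)\times L^2(\Omega)^n\times H^{-1}(\Omega): \operatorname{div}\boldsymbol{\sigma}+\lambda\in L^2(\Omega)\}$ with norm $\|(u,\boldsymbol{\sigma},\lambda)\|_U^2:=\|\nabla u\|^2+\|\boldsymbol{\sigma}\|^2+\|\operatorname{div}\boldsymbol{\sigma}+\lambda\|^2$. $K^1:=\{(u,\boldsymbol{\sigma},\lambda)\in U:\lambda\ge0\}$. For $\boldsymbol{u}=(u,\boldsymbol{\sigma},\lambda)$,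 $\boldsymbol{v}=(v,\boldsymbol{\tau},\mu)\in U$: $c_\beta(\boldsymbol{u},\boldsymbol{v}):=\beta(\operatorname{div}\boldsymbol{\sigma}+\lambda,\operatorname{div}\boldsymbol{\tau}+\mu)+(\nabla u-\boldsymbol{\sigma},\nabla v-\boldsymbol{\tau})+\langle\mu,u\rangle$, $H_\beta(\boldsymbol{v}):=-\beta(f,\operatorname{div}\boldsymbol{\tau}+\mu)+\langle\mu,g\rangle$. Both variational inequalities are uniquely solvable. The solution $\boldsymbol{u}$ of the first one is $(u,\nabla u,-\Delta u-f)$, where $u\in H_0^1(\Omega)$, $u\ge g$, is the solution of the classical obstacle problem $(\nabla u,\nabla(v-u))\ge(f,v-u)$ for all $v\in H_0^1(\Omega)$, $v\ge g$. *)

theory Defs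
  imports "HOL-Analysis.Analysis" "HOL-Library.Function_Algebras"
begin

text \<open>
  Pointwise real vector space structure on functions, so that \<open>convex\<close>, \<open>+\<close>, \<open>-\<close> and \<open>*\<^sub>R\<close> of the
  library apply to functions, to functionals and to tuples of these.
\<close>

instantiation "fun" :: (type, real_vector) real_vector
begin

definition scaleR_fun :: "real \<Rightarrow> ('a \<Rightarrow> 'b) \<Rightarrow> 'a \<Rightarrow> 'b" where
  "scaleR_fun c f = (\<lambda>x. c *\<^sub>R f x)"

instance
  by standard (auto simp: scaleR_fun_def fun_eq_iff scaleR_add_right scaleR_add_left)

end

text \<open>
  Near each boundary point, in suitable orthogonal coordinates with vertical direction \<open>e\<close>, the set
  is the strict epigraph of a Lipschitz function \<open>\<gamma>\<close> on the hyperplane orthogonal to \<open>e\<close>.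
\<close>

definition lipschitz_boundary :: "(real ^ 'n) set \<Rightarrow> bool" where
  "lipschitz_boundary \<Omega> \<longleftrightarrow>
     (\<forall>x\<in>frontier \<Omega>. \<exists>V e \<gamma> L. open V \<and> x \<in> V \<and> norm e = 1 \<and>
        L-lipschitz_on {z. z \<bullet> e = 0} (\<gamma> :: real ^ 'n \<Rightarrow> real) \<and>
        \<Omega> \<inter> V = {y \<in> V. y \<bullet> e > \<gamma> (y - (y \<bullet> e) *\<^sub>R e)})"

definition polyhedral_lipschitz_domain :: "(real ^ 'n) set \<Rightarrow> bool" where
  "polyhedral_lipschitz_domain \<Omega> \<longleftrightarrow>
     open \<Omega> \<and> connected \<Omega> \<and> \<Omega> \<noteq> {} \<and> bounded \<Omega> \<and> lipschitz_boundary \<Omega> \<and>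
     (\<exists>F. finite F \<and> (\<forall>P\<in>F. polytope P) \<and> closure \<Omega> = \<Union>F)"

text \<open>
  Elements of \<open>L\<^sup>2(\<Omega>)\<close> are represented by functions on the whole space; two functions represent
  the same element iff they agree almost everywhere in \<open>\<Omega>\<close>.  The definitions are used for scalar
  and for vector fields.
\<close>

definition L2 :: "(real ^ 'n) set \<Rightarrow> (real ^ 'n \<Rightarrow> 'b::euclidean_space) set" where
  "L2 \<Omega> = {f \<in> borel_measurable (lebesgue_on \<Omega>). integrable (lebesgue_on \<Omega>) (\<lambda>x. (norm (f x))\<^sup>2)}"

definition L2_inner ::
  "(real ^ 'n) set \<Rightarrow> (real ^ 'n \<Rightarrow> 'b::euclidean_space) \<Rightarrow> (real ^ 'n \<Rightarrow> 'b) \<Rightarrow> real" where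
  "L2_inner \<Omega> f g = (\<integral>x. f x \<bullet> g x \<partial>lebesgue_on \<Omega>)"

definition L2_norm :: "(real ^ 'n) set \<Rightarrow> (real ^ 'n \<Rightarrow> 'b::euclidean_space) \<Rightarrow> real" where
  "L2_norm \<Omega> f = sqrt (L2_inner \<Omega> f f)"

definition partial :: "'n \<Rightarrow> (real ^ 'n \<Rightarrow> real) \<Rightarrow> real ^ 'n \<Rightarrow> real" where
  "partial i f x = frechet_derivative f (at x) (axis i 1)"

text \<open>All iterated partial derivatives exist and are (totally) differentiable, i.e. \<open>C\<^sup>\<infinity>\<close>.\<close>

definition smooth :: "(real ^ 'n \<Rightarrow> real) \<Rightarrow> bool" where
  "smooth f \<longleftrightarrow> (\<forall>is x. fold partial is f differentiable (at x))"

definition test_functions :: "(real ^ 'n) set \<Rightarrow> (real ^ 'n \<Rightarrow> real) set" where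
  "test_functions \<Omega> = {\<phi>. smooth \<phi> \<and> (\<exists>K. compact K \<and> K \<subseteq> \<Omega> \<and> (\<forall>x. x \<notin> K \<longrightarrow> \<phi> x = 0))}"

definition is_weak_gradient ::
  "(real ^ 'n) set \<Rightarrow> (real ^ 'n \<Rightarrow> real) \<Rightarrow> (real ^ 'n \<Rightarrow> real ^ 'n) \<Rightarrow> bool" where
  "is_weak_gradient \<Omega> u p \<longleftrightarrow> p \<in> L2 \<Omega> \<and>
     (\<forall>\<phi>\<in>test_functions \<Omega>. \<forall>i. L2_inner \<Omega> u (partial i \<phi>) = - L2_inner \<Omega> (\<lambda>x. p x $ i) \<phi>)"

definition H1 :: "(real ^ 'n) set \<Rightarrow> (real ^ 'n \<Rightarrow> real) set" where
  "H1 \<Omega> = {u \<in> L2 \<Omega>. \<exists>p. is_weak_gradient \<Omega> u p}"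

text \<open>The weak gradient is unique up to null sets; \<open>grad\<close> selects a representative.\<close>

definition grad :: "(real ^ 'n) set \<Rightarrow> (real ^ 'n \<Rightarrow> real) \<Rightarrow> real ^ 'n \<Rightarrow> real ^ 'n" where
  "grad \<Omega> u = (SOME p. is_weak_gradient \<Omega> u p)"

definition H1_norm :: "(real ^ 'n) set \<Rightarrow> (real ^ 'n \<Rightarrow> real) \<Rightarrow> real" where
  "H1_norm \<Omega> u = sqrt ((L2_norm \<Omega> u)\<^sup>2 + (L2_norm \<Omega> (grad \<Omega> u))\<^sup>2)"

definition H10 :: "(real ^ 'n) set \<Rightarrow> (real ^ 'n \<Rightarrow> real) set" where
  "H10 \<Omega> = {u \<in> H1 \<Omega>. \<exists>\<phi>. (\<forall>k. \<phi> k \<in> test_functions \<Omega>) \<and> (\<lambda>k. H1_norm \<Omega> (u - \<phi> k)) \<longlonglongrightarrow> 0}"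

definition friedrichs_constant :: "(real ^ 'n) set \<Rightarrow> real \<Rightarrow> bool" where
  "friedrichs_constant \<Omega> C \<longleftrightarrow> 0 < C \<and> C \<le> diameter \<Omega> \<and>
     (\<forall>v\<in>H10 \<Omega>. L2_norm \<Omega> v \<le> C * L2_norm \<Omega> (grad \<Omega> v))"

text \<open>
  Bounded linear functionals on \<open>H10 \<Omega>\<close>; their values outside \<open>H10 \<Omega>\<close> are irrelevant.
  Boundedness makes them compatible with equality almost everywhere.
\<close>

definition Hm1 :: "(real ^ 'n) set \<Rightarrow> ((real ^ 'n \<Rightarrow> real) \<Rightarrow> real) set" where
  "Hm1 \<Omega> = {l. (\<forall>v\<in>H10 \<Omega>. \<forall>w\<in>H10 \<Omega>. l (v + w) = l v + l w) \<and>
               (\<forall>c. \<forall>v\<in>H10 \<Omega>. l (c *\<^sub>R v) = c * l v) \<and>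
               (\<exists>C. \<forall>v\<in>H10 \<Omega>. \<bar>l v\<bar> \<le> C * H1_norm \<Omega> v)}"

definition nonneg_functional :: "(real ^ 'n) set \<Rightarrow> ((real ^ 'n \<Rightarrow> real) \<Rightarrow> real) \<Rightarrow> bool" where
  "nonneg_functional \<Omega> l \<longleftrightarrow> (\<forall>v\<in>H10 \<Omega>. (AE x in lebesgue_on \<Omega>. v x \<ge> 0) \<longrightarrow> l v \<ge> 0)"

definition divergence ::
  "(real ^ 'n) set \<Rightarrow> (real ^ 'n \<Rightarrow> real ^ 'n) \<Rightarrow> (real ^ 'n \<Rightarrow> real) \<Rightarrow> real" where
  "divergence \<Omega> \<sigma> v = - L2_inner \<Omega> \<sigma> (grad \<Omega> v)"

text \<open>
  \<open>w\<close> represents the functional \<open>l\<close> under the embedding of \<open>L\<^sup>2(\<Omega>)\<close> into \<open>H\<^sup>-\<^sup>1(\<Omega>)\<close>.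
\<close>

definition L2_represents ::
  "(real ^ 'n) set \<Rightarrow> ((real ^ 'n \<Rightarrow> real) \<Rightarrow> real) \<Rightarrow> (real ^ 'n \<Rightarrow> real) \<Rightarrow> bool" where
  "L2_represents \<Omega> l w \<longleftrightarrow> w \<in> L2 \<Omega> \<and> (\<forall>v\<in>H10 \<Omega>. l v = L2_inner \<Omega> w v)"

type_synonym 'n triple =
  "(real ^ 'n \<Rightarrow> real) \<times> (real ^ 'n \<Rightarrow> real ^ 'n) \<times> ((real ^ 'n \<Rightarrow> real) \<Rightarrow> real)"

definition U_space :: "(real ^ 'n) set \<Rightarrow> 'n triple set" where
  "U_space \<Omega> = {(u, \<sigma>, l). u \<in> H10 \<Omega> \<and> \<sigma> \<in> L2 \<Omega> \<and> l \<in> Hm1 \<Omega> \<and>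
                           (\<exists>w. L2_represents \<Omega> (divergence \<Omega> \<sigma> + l) w)}"

text \<open>The \<open>L\<^sup>2\<close> function \<open>div \<sigma> + \<lambda>\<close>, unique up to null sets for triples in \<open>U\<close>.\<close>

definition div_plus ::
  "(real ^ 'n) set \<Rightarrow> (real ^ 'n \<Rightarrow> real ^ 'n) \<Rightarrow> ((real ^ 'n \<Rightarrow> real) \<Rightarrow> real) \<Rightarrow> real ^ 'n \<Rightarrow> real"
  where "div_plus \<Omega> \<sigma> l = (SOME w. L2_represents \<Omega> (divergence \<Omega> \<sigma> + l) w)"

fun U_norm :: "(real ^ 'n) set \<Rightarrow> 'n triple \<Rightarrow> real" where
  "U_norm \<Omega> (u, \<sigma>, l) =
     sqrt ((L2_norm \<Omega> (grad \<Omega> u))\<^sup>2 + (L2_norm \<Omega> \<sigma>)\<^sup>2 + (L2_norm \<Omega> (div_plus \<Omega> \<sigma> l))\<^sup>2)"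

definition K1 :: "(real ^ 'n) set \<Rightarrow> 'n triple set" where
  "K1 \<Omega> = {(u, \<sigma>, l) \<in> U_space \<Omega>. nonneg_functional \<Omega> l}"

fun c_form :: "(real ^ 'n) set \<Rightarrow> real \<Rightarrow> 'n triple \<Rightarrow> 'n triple \<Rightarrow> real" where
  "c_form \<Omega> \<beta> (u, \<sigma>, l) (v, \<tau>, m) =
     \<beta> * L2_inner \<Omega> (div_plus \<Omega> \<sigma> l) (div_plus \<Omega> \<tau> m) +
     L2_inner \<Omega> (grad \<Omega> u - \<sigma>) (grad \<Omega> v - \<tau>) + m u"

fun H_form ::
  "(real ^ 'n) set \<Rightarrow> real \<Rightarrow> (real ^ 'n \<Rightarrow> real) \<Rightarrow> (real ^ 'n \<Rightarrow> real) \<Rightarrow> 'n triple \<Rightarrow> real" where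
  "H_form \<Omega> \<beta> f g (v, \<tau>, m) = - \<beta> * L2_inner \<Omega> f (div_plus \<Omega> \<tau> m) + m g"

definition VI_solution ::
  "(real ^ 'n) set \<Rightarrow> real \<Rightarrow> (real ^ 'n \<Rightarrow> real) \<Rightarrow> (real ^ 'n \<Rightarrow> real) \<Rightarrow> 'n triple set \<Rightarrow>
   'n triple \<Rightarrow> bool" where
  "VI_solution \<Omega> \<beta> f g K u \<longleftrightarrow>
     u \<in> K \<and> (\<forall>v\<in>K. c_form \<Omega> \<beta> u (v - u) \<ge> H_form \<Omega> \<beta> f g (v - u))"

text \<open>
  Closedness with respect to \<open>U_norm\<close>.  As \<open>U_norm\<close> does not see the choice of representatives, a
  closed set contains with a triple all triples representing the same element of \<open>U\<close>.
\<close>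

definition closed_in_U :: "(real ^ 'n) set \<Rightarrow> 'n triple set \<Rightarrow> bool" where
  "closed_in_U \<Omega> K \<longleftrightarrow>
     (\<forall>X. \<forall>v\<in>U_space \<Omega>. (\<forall>k. X k \<in> K) \<and> (\<lambda>k. U_norm \<Omega> (X k - v)) \<longlonglongrightarrow> 0 \<longrightarrow> v \<in> K)"

end

theory Submission
  imports Defs
begin

text \<open>
  The error is estimated by Falk's technique.  The bilinear form \<open>c\<^sub>\<beta>\<close> is coercive with constant \<open>1 / 4\<close>
  (\<open>c_form_coercive\<close>) and bounded with constant \<open>M = 2 \<beta> + 5\<close> (\<open>c_form_bounded\<close>) in the norm of \<open>U\<close>.  Both
  constants depend on \<open>\<beta>\<close> only, because \<open>\<beta> \<ge> 1 + C\<^sub>F\<^sup>2\<close>.  For the error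
  \<open>e = \<^bold>u - \<^bold>u\<^sub>h\<close> and any \<open>\<^bold>v\<^sub>h \<in> K\<^sub>h\<close>,
  \<open>c\<^sub>\<beta>(e, e) = c\<^sub>\<beta>(e, \<^bold>u - \<^bold>v\<^sub>h) + c\<^sub>\<beta>(e, \<^bold>v\<^sub>h - \<^bold>u\<^sub>h)\<close>,
  and by the discrete variational inequality the last term is at most the residual
  \<open>c\<^sub>\<beta>(\<^bold>u, \<^bold>v\<^sub>h - \<^bold>u\<^sub>h) - H\<^sub>\<beta>(\<^bold>v\<^sub>h - \<^bold>u\<^sub>h)\<close> of the exact solution.

  The exact solution satisfies \<open>\<sigma> = \<nabla>u\<close> and \<open>div \<sigma> + \<lambda> = - f\<close> (\<open>VI_solution_first_order\<close>).  Hence all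
  \<open>L\<^sup>2\<close> terms of the residual cancel, and what remains is \<open>\<langle>\<mu>\<^sub>h - \<lambda>\<^sub>h, u - g\<rangle>\<close>
  (\<open>VI_solution_residual\<close>).  The same identity, used in the continuous variational inequality, shows
  \<open>\<langle>\<mu> - \<lambda>, u - g\<rangle> \<ge> 0\<close> for \<open>\<mu> \<ge> 0\<close>.  Therefore the residual is at most
  \<open>\<langle>\<mu>\<^sub>h - \<lambda>, u - g\<rangle> + \<langle>\<mu> - \<lambda>\<^sub>h, u - g\<rangle>\<close>.  Young's inequality then gives the estimate with
  \<open>16 M\<^sup>2 + 8\<close> for any \<open>\<^bold>v\<^sub>h \<in> K\<^sub>h\<close> and \<open>\<^bold>v \<in> K\<^sup>1\<close> (\<open>VI_error_estimate\<close>).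

  Gradients and the \<open>L\<^sup>2\<close> representatives of \<open>div \<sigma> + \<lambda>\<close> are given by choice.  That they depend linearly
  on their arguments, up to null sets, is the fundamental lemma of the calculus of variations
  (\<open>AE_zero_if_orthogonal_to_box_bumps\<close>), proved here with explicit smooth bumps supported in boxes.  The
  same bumps give the identity \<open>div \<sigma> + \<lambda> = - f\<close>, because each of them is the divergence of a smooth
  vector field.
\<close>

section \<open>Square integrable functions\<close>

lemma integrable_L2_product:
  assumes "f \<in> L2 \<Omega>" "g \<in> L2 \<Omega>"
  shows "integrable (lebesgue_on \<Omega>) (\<lambda>x. f x \<bullet> g x)"
proof (rule Bochner_Integration.integrable_bound)
  show "integrable (lebesgue_on \<Omega>) (\<lambda>x. (norm (f x))\<^sup>2 + (norm (g x))\<^sup>2)"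
    using assms by (auto simp: L2_def)
  show "(\<lambda>x. f x \<bullet> g x) \<in> borel_measurable (lebesgue_on \<Omega>)"
    using assms by (auto simp: L2_def)
  show "AE x in lebesgue_on \<Omega>. norm (f x \<bullet> g x) \<le> norm ((norm (f x))\<^sup>2 + (norm (g x))\<^sup>2)"
  proof (rule AE_I2)
    fix x
    have "\<bar>f x \<bullet> g x\<bar> \<le> norm (f x) * norm (g x)" by (rule Cauchy_Schwarz_ineq2)
    moreover have "2 * (norm (f x) * norm (g x)) \<le> (norm (f x))\<^sup>2 + (norm (g x))\<^sup>2"
      using zero_le_power2[of "norm (f x) - norm (g x)"] by (simp add: power2_diff)
    moreover have "0 \<le> norm (f x) * norm (g x)" by simp
    ultimately show "norm (f x \<bullet> g x) \<le> norm ((norm (f x))\<^sup>2 + (norm (g x))\<^sup>2)"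
      by simp
  qed
qed

lemma L2_add: "f \<in> L2 \<Omega> \<Longrightarrow> g \<in> L2 \<Omega> \<Longrightarrow> f + g \<in> L2 \<Omega>"
  using integrable_L2_product[of f \<Omega> g] integrable_L2_product[of g \<Omega> g]
  by (auto simp: L2_def plus_fun_def power2_norm_eq_inner inner_add_left inner_add_right inner_commute)

lemma L2_scaleR: "f \<in> L2 \<Omega> \<Longrightarrow> c *\<^sub>R f \<in> L2 \<Omega>"
  by (auto simp: L2_def scaleR_fun_def power_mult_distrib)

lemma L2_diff: "f \<in> L2 \<Omega> \<Longrightarrow> g \<in> L2 \<Omega> \<Longrightarrow> f - g \<in> L2 \<Omega>"
  using L2_add[of f \<Omega> "(-1) *\<^sub>R g"] L2_scaleR[of g \<Omega> "-1"] by simp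

lemma L2_zero: "0 \<in> L2 \<Omega>"
  by (auto simp: L2_def zero_fun_def)

lemma L2_component:
  fixes p :: "real ^ 'n \<Rightarrow> real ^ 'm"
  assumes p: "p \<in> L2 \<Omega>"
  shows "(\<lambda>x. p x $ i) \<in> L2 \<Omega>"
proof -
  have m: "(\<lambda>x. p x $ i) \<in> borel_measurable (lebesgue_on \<Omega>)"
    using p borel_measurable_inner[of p "lebesgue_on \<Omega>" "\<lambda>_. axis i 1"]
    by (simp add: L2_def inner_axis)
  have "integrable (lebesgue_on \<Omega>) (\<lambda>x. (norm (p x $ i))\<^sup>2)"
  proof (rule Bochner_Integration.integrable_bound)
    show "integrable (lebesgue_on \<Omega>) (\<lambda>x. (norm (p x))\<^sup>2)" using p by (auto simp: L2_def)
    show "(\<lambda>x. (norm (p x $ i))\<^sup>2) \<in> borel_measurable (lebesgue_on \<Omega>)" using m by auto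
    show "AE x in lebesgue_on \<Omega>. norm ((norm (p x $ i))\<^sup>2) \<le> norm ((norm (p x))\<^sup>2)"
      by (rule AE_I2) (simp add: power_mono component_le_norm_cart abs_le_square_iff[symmetric])
  qed
  with m show ?thesis by (auto simp: L2_def)
qed

lemma L2_inner_commute: "L2_inner \<Omega> f g = L2_inner \<Omega> g f"
  by (simp add: L2_inner_def inner_commute)

lemma L2_inner_add_left:
  "f \<in> L2 \<Omega> \<Longrightarrow> f' \<in> L2 \<Omega> \<Longrightarrow> g \<in> L2 \<Omega> \<Longrightarrow>
   L2_inner \<Omega> (f + f') g = L2_inner \<Omega> f g + L2_inner \<Omega> f' g"
  by (simp add: L2_inner_def inner_add_left integrable_L2_product)

lemma L2_inner_diff_left:
  "f \<in> L2 \<Omega> \<Longrightarrow> f' \<in> L2 \<Omega> \<Longrightarrow> g \<in> L2 \<Omega> \<Longrightarrow>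
   L2_inner \<Omega> (f - f') g = L2_inner \<Omega> f g - L2_inner \<Omega> f' g"
  by (simp add: L2_inner_def inner_diff_left integrable_L2_product fun_diff_def)

lemma L2_inner_scaleR_left: "L2_inner \<Omega> (c *\<^sub>R f) g = c * L2_inner \<Omega> f g"
  by (simp add: L2_inner_def scaleR_fun_def)

lemma L2_inner_add_right:
  "f \<in> L2 \<Omega> \<Longrightarrow> f' \<in> L2 \<Omega> \<Longrightarrow> g \<in> L2 \<Omega> \<Longrightarrow>
   L2_inner \<Omega> g (f + f') = L2_inner \<Omega> g f + L2_inner \<Omega> g f'"
  by (simp add: L2_inner_commute[of _ g] L2_inner_add_left)

lemma L2_inner_diff_right:
  "f \<in> L2 \<Omega> \<Longrightarrow> f' \<in> L2 \<Omega> \<Longrightarrow> g \<in> L2 \<Omega> \<Longrightarrow>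
   L2_inner \<Omega> g (f - f') = L2_inner \<Omega> g f - L2_inner \<Omega> g f'"
  by (simp add: L2_inner_commute[of _ g] L2_inner_diff_left)

lemma L2_inner_scaleR_right: "L2_inner \<Omega> g (c *\<^sub>R f) = c * L2_inner \<Omega> g f"
  by (simp add: L2_inner_commute[of _ g] L2_inner_scaleR_left)

lemma L2_inner_zero_left [simp]: "L2_inner \<Omega> 0 g = 0"
  by (simp add: L2_inner_def)

lemma L2_inner_zero_right [simp]: "L2_inner \<Omega> g 0 = 0"
  by (simp add: L2_inner_def)

lemma L2_inner_uminus_right: "L2_inner \<Omega> g (- f) = - L2_inner \<Omega> g f"
  using L2_inner_scaleR_right[of \<Omega> g "-1" f] by simp

lemma L2_inner_cong_AE:
  assumes "f \<in> L2 \<Omega>" "f' \<in> L2 \<Omega>" "g \<in> L2 \<Omega>" "g' \<in> L2 \<Omega>"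
    and "AE x in lebesgue_on \<Omega>. f x = f' x" "AE x in lebesgue_on \<Omega>. g x = g' x"
  shows "L2_inner \<Omega> f g = L2_inner \<Omega> f' g'"
  unfolding L2_inner_def
proof (rule integral_cong_AE)
  show "AE x in lebesgue_on \<Omega>. f x \<bullet> g x = f' x \<bullet> g' x" using assms(5,6) by eventually_elim simp
qed (use assms in \<open>auto simp: L2_def\<close>)

lemma L2_inner_self_nonneg: "0 \<le> L2_inner \<Omega> f f"
  by (simp add: L2_inner_def)

lemma L2_norm_nonneg: "0 \<le> L2_norm \<Omega> f"
  by (simp add: L2_norm_def L2_inner_self_nonneg)

lemma L2_norm_power2: "(L2_norm \<Omega> f)\<^sup>2 = L2_inner \<Omega> f f"
  by (simp add: L2_norm_def L2_inner_self_nonneg)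

lemma L2_norm_cong_AE:
  "f \<in> L2 \<Omega> \<Longrightarrow> f' \<in> L2 \<Omega> \<Longrightarrow> AE x in lebesgue_on \<Omega>. f x = f' x \<Longrightarrow> L2_norm \<Omega> f = L2_norm \<Omega> f'"
  by (simp add: L2_norm_def L2_inner_cong_AE[of f \<Omega> f' f f'])

lemma L2_norm_scaleR: "L2_norm \<Omega> (c *\<^sub>R f) = \<bar>c\<bar> * L2_norm \<Omega> f"
  by (simp add: L2_norm_def L2_inner_scaleR_left L2_inner_scaleR_right real_sqrt_mult
      mult.assoc[symmetric])

text \<open>
  A field of norm zero vanishes only up to a null set.  Identities between gradients and divergences
  are therefore identities almost everywhere throughout.
\<close>

lemma L2_inner_self_eq_0_AE:
  assumes "f \<in> L2 \<Omega>" "L2_inner \<Omega> f f = 0"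
  shows "AE x in lebesgue_on \<Omega>. f x = 0"
  using assms integral_nonneg_eq_0_iff_AE[OF integrable_L2_product[OF assms(1) assms(1)]]
  by (simp add: L2_inner_def)

lemma L2_Cauchy_Schwarz:
  assumes f: "f \<in> L2 \<Omega>" and g: "g \<in> L2 \<Omega>"
  shows "\<bar>L2_inner \<Omega> f g\<bar> \<le> L2_norm \<Omega> f * L2_norm \<Omega> g"
proof -
  let ?a = "L2_inner \<Omega> f f" and ?b = "L2_inner \<Omega> f g" and ?c = "L2_inner \<Omega> g g"
  have quad: "0 \<le> ?a - 2 * t * ?b + t\<^sup>2 * ?c" for t
  proof -
    have "0 \<le> L2_inner \<Omega> (f - t *\<^sub>R g) (f - t *\<^sub>R g)" by (rule L2_inner_self_nonneg)
    also have "\<dots> = ?a - 2 * t * ?b + t\<^sup>2 * ?c"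
      using f g
      by (simp add: L2_inner_diff_left L2_inner_diff_right L2_diff L2_scaleR L2_inner_scaleR_left
          L2_inner_scaleR_right L2_inner_commute[of \<Omega> g f] power2_eq_square algebra_simps)
    finally show ?thesis .
  qed
  have "?b\<^sup>2 \<le> ?a * ?c"
  proof (cases "?c = 0")
    case True
    then have "AE x in lebesgue_on \<Omega>. g x = 0" using g L2_inner_self_eq_0_AE by blast
    then have "?b = L2_inner \<Omega> f 0"
      using f g L2_zero by (intro L2_inner_cong_AE) auto
    with True show ?thesis by simp
  next
    case False
    then have c: "?c > 0" using L2_inner_self_nonneg[of \<Omega> g] by linarith
    have "0 \<le> ?a - ?b\<^sup>2 / ?c"
      using quad[of "?b / ?c"] c by (simp add: power2_eq_square field_simps)
    with c show ?thesis by (simp add: field_simps)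
  qed
  then have "\<bar>?b\<bar>\<^sup>2 \<le> (L2_norm \<Omega> f * L2_norm \<Omega> g)\<^sup>2"
    by (simp add: power_mult_distrib L2_norm_power2)
  then show ?thesis by (rule power2_le_imp_le) (simp add: L2_norm_nonneg)
qed

lemma L2_norm_triangle:
  assumes f: "f \<in> L2 \<Omega>" and g: "g \<in> L2 \<Omega>"
  shows "L2_norm \<Omega> (f + g) \<le> L2_norm \<Omega> f + L2_norm \<Omega> g"
proof (rule power2_le_imp_le)
  have "(L2_norm \<Omega> (f + g))\<^sup>2 = (L2_norm \<Omega> f)\<^sup>2 + 2 * L2_inner \<Omega> f g + (L2_norm \<Omega> g)\<^sup>2"
    using f g by (simp add: L2_norm_power2 L2_inner_add_left L2_inner_add_right L2_add
        L2_inner_commute[of \<Omega> g f])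
  also have "\<dots> \<le> (L2_norm \<Omega> f + L2_norm \<Omega> g)\<^sup>2"
    using L2_Cauchy_Schwarz[OF f g] by (simp add: power2_sum)
  finally show "(L2_norm \<Omega> (f + g))\<^sup>2 \<le> (L2_norm \<Omega> f + L2_norm \<Omega> g)\<^sup>2" .
qed (simp add: L2_norm_nonneg)

lemma L2_norm_diff_triangle:
  assumes f: "f \<in> L2 \<Omega>" and g: "g \<in> L2 \<Omega>"
  shows "L2_norm \<Omega> (f - g) \<le> L2_norm \<Omega> f + L2_norm \<Omega> g"
  using L2_norm_triangle[OF f L2_scaleR[OF g, of "-1"]] L2_norm_scaleR[of \<Omega> "-1" g] by simp

text \<open>
  A continuous function on the whole space is bounded on the compact closure of \<open>\<Omega>\<close>, and \<open>\<Omega>\<close> has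
  finite measure.
\<close>

lemma continuous_on_bounded_open_in_L2:
  fixes f :: "real ^ 'n \<Rightarrow> 'b::euclidean_space"
  assumes "open \<Omega>" "bounded \<Omega>" "continuous_on UNIV f"
  shows "f \<in> L2 \<Omega>"
proof -
  have m: "f \<in> borel_measurable (lebesgue_on \<Omega>)"
    using assms by (intro continuous_imp_measurable_on_sets_lebesgue)
      (auto intro: continuous_on_subset)
  have lm: "\<Omega> \<in> lmeasurable" using assms lmeasurable_open by blast
  have "emeasure (lebesgue_on \<Omega>) (space (lebesgue_on \<Omega>)) = emeasure lebesgue \<Omega>"
    using lm by (subst emeasure_restrict_space) auto
  then interpret finite_measure "lebesgue_on \<Omega>"
    using fmeasurableD2[OF lm] by (intro finite_measureI) simp
  have "compact (f ` closure \<Omega>)"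
    using assms by (intro compact_continuous_image) (auto intro: continuous_on_subset)
  then obtain B where "\<forall>y\<in>f ` closure \<Omega>. norm y \<le> B"
    using compact_imp_bounded bounded_iff by metis
  then have B: "norm (f x) \<le> B" if "x \<in> \<Omega>" for x using that closure_subset by blast
  have "integrable (lebesgue_on \<Omega>) (\<lambda>x. (norm (f x))\<^sup>2)"
  proof (rule integrable_const_bound[of _ "B\<^sup>2"])
    show "AE x in lebesgue_on \<Omega>. norm ((norm (f x))\<^sup>2) \<le> B\<^sup>2"
      using B by (intro AE_I2) (auto intro: power_mono)
  qed (use m in auto)
  with m show ?thesis by (auto simp: L2_def)
qed

section \<open>Smooth functions and bumps\<close>

lemma partial_has_derivative:
  "(f has_derivative f') (at x) \<Longrightarrow> partial i f x = f' (axis i 1)"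
  unfolding partial_def by (metis frechet_derivative_at)

lemma smooth_differentiable: "smooth f \<Longrightarrow> f differentiable (at x)"
  unfolding smooth_def by (metis fold_simps(1))

lemma smooth_partial: "smooth f \<Longrightarrow> smooth (partial i f)"
  unfolding smooth_def by (metis fold_simps(2))

lemma smooth_has_derivative:
  "smooth f \<Longrightarrow> (f has_derivative frechet_derivative f (at x)) (at x)"
  using smooth_differentiable frechet_derivative_works by blast

lemma smooth_continuous_on: "smooth f \<Longrightarrow> continuous_on S f"
  by (meson continuous_at_imp_continuous_on differentiable_imp_continuous_within smooth_differentiable)

text \<open>
  Smoothness speaks of all iterated partial derivatives, so it is a greatest fixed point: any class
  of differentiable functions that is closed under partial derivatives consists of smooth functions.
\<close>

lemma smooth_coinduct [consumes 1, case_names differentiable partial]: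
  assumes "P f"
    and diff: "\<And>f x. P f \<Longrightarrow> f differentiable (at x)"
    and part: "\<And>f i. P f \<Longrightarrow> P (partial i f)"
  shows "smooth f"
  unfolding smooth_def
proof (intro allI)
  fix "is" x
  show "fold partial is f differentiable (at x)"
    using \<open>P f\<close> by (induction "is" arbitrary: f) (auto intro: diff part)
qed

lemma smooth_if_partials_smooth:
  assumes "\<And>x. f differentiable (at x)" "\<And>i. smooth (partial i f)"
  shows "smooth f"
  unfolding smooth_def
proof (intro allI)
  fix "is" x
  show "fold partial is f differentiable (at x)"
    using assms by (cases "is") (auto simp: smooth_def)
qed

lemma partial_add:
  assumes "\<And>x. f differentiable (at x)" "\<And>x. g differentiable (at x)"
  shows "partial i (f + g) = partial i f + partial i g"
proof
  fix x
  have "(f + g has_derivative (\<lambda>h. frechet_derivative f (at x) h + frechet_derivative g (at x) h)) (at x)"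
    unfolding plus_fun_def
    using assms frechet_derivative_works by (intro has_derivative_add) blast+
  from partial_has_derivative[OF this]
  show "partial i (f + g) x = (partial i f + partial i g) x" by (simp add: partial_def)
qed

lemma partial_mult:
  assumes "\<And>x. f differentiable (at x)" "\<And>x. g differentiable (at x)"
  shows "partial i (f * g) = f * partial i g + partial i f * g"
proof
  fix x
  have "(f * g has_derivative
      (\<lambda>h. f x * frechet_derivative g (at x) h + frechet_derivative f (at x) h * g x)) (at x)"
    unfolding times_fun_def
    using assms frechet_derivative_works by (intro has_derivative_mult) blast+
  from partial_has_derivative[OF this]
  show "partial i (f * g) x = (f * partial i g + partial i f * g) x" by (simp add: partial_def)
qed

text \<open>
  The product rule turns a product of smooth functions into a sum of two such products.  Products
  alone are therefore not a class to which coinduction applies, but their finite sums are.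
\<close>

inductive smooth_product_sum :: "(real ^ 'n \<Rightarrow> real) \<Rightarrow> bool" where
  product: "smooth f \<Longrightarrow> smooth g \<Longrightarrow> smooth_product_sum (f * g)"
| sum: "smooth_product_sum f \<Longrightarrow> smooth_product_sum g \<Longrightarrow> smooth_product_sum (f + g)"

lemma smooth_product_sum_differentiable:
  "smooth_product_sum f \<Longrightarrow> f differentiable (at x)"
proof (induction rule: smooth_product_sum.induct)
  case (product f g)
  then show ?case
    unfolding times_fun_def by (intro differentiable_mult smooth_differentiable)
next
  case (sum f g)
  then show ?case unfolding plus_fun_def by (intro differentiable_add)
qed

lemma smooth_product_sum_partial:
  "smooth_product_sum f \<Longrightarrow> smooth_product_sum (partial i f)"
proof (induction rule: smooth_product_sum.induct)
  case (product f g)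
  then show ?case
    by (subst partial_mult)
      (intro smooth_differentiable smooth_product_sum.intros smooth_partial | assumption)+
next
  case (sum f g)
  then show ?case
    by (subst partial_add)
      (intro smooth_product_sum_differentiable smooth_product_sum.sum | assumption)+
qed

lemma smooth_product_sum_smooth: "smooth_product_sum f \<Longrightarrow> smooth f"
  by (rule smooth_coinduct[where P = smooth_product_sum])
    (auto intro: smooth_product_sum_differentiable smooth_product_sum_partial)

lemma smooth_mult: "smooth f \<Longrightarrow> smooth g \<Longrightarrow> smooth (f * g)"
  by (simp add: smooth_product_sum_smooth smooth_product_sum.product)

text \<open>
  The factor \<open>c\<close> is there to make the class closed under partial derivatives: a derivative in another
  coordinate direction than \<open>j\<close> is the case \<open>c = 0\<close>.
\<close>

lemma smooth_coordinate:
  fixes D :: "nat \<Rightarrow> real \<Rightarrow> real"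
  assumes D: "\<And>n t. (D n has_real_derivative D (Suc n) t) (at t)"
  shows "smooth (\<lambda>x :: real ^ 'n. c * D n (s * x $ j + d))"
proof -
  let ?F = "\<lambda>c n (x :: real ^ 'n). c * D n (s * x $ j + d)"
  have der: "(?F c n has_derivative (\<lambda>h. c * (D (Suc n) (s * x $ j + d) * (s * h $ j)))) (at x)"
    for c n x
  proof -
    have "((\<lambda>x :: real ^ 'n. s * x $ j + d) has_derivative (\<lambda>h. s * h $ j)) (at x)"
      by (auto intro!: derivative_eq_intros bounded_linear.has_derivative[OF bounded_linear_vec_nth])
    from has_derivative_compose[OF this D[of n, unfolded has_field_derivative_def]]
    show ?thesis by (intro has_derivative_mult_right) simp
  qed
  have part: "partial i (?F c n) = ?F (c * s * axis i 1 $ j) (Suc n)" for i c n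
    using partial_has_derivative[OF der] by (auto simp: fun_eq_iff)
  show ?thesis
  proof (rule smooth_coinduct[where P = "\<lambda>f. \<exists>c n. f = ?F c n"])
    fix f :: "real ^ 'n \<Rightarrow> real" and x assume "\<exists>c n. f = ?F c n"
    then show "f differentiable (at x)" using der unfolding differentiable_def by blast
  next
    fix f :: "real ^ 'n \<Rightarrow> real" and i assume "\<exists>c n. f = ?F c n"
    then show "\<exists>c n. partial i f = ?F c n" using part by metis
  qed blast
qed

lemma smooth_const: "smooth (\<lambda>x :: real ^ 'n. c)"
  using smooth_coordinate[of "\<lambda>n t. if n = 0 then 1 else 0" c 0] by simp

lemma smooth_prod:
  "finite A \<Longrightarrow> (\<And>j. j \<in> A \<Longrightarrow> smooth (F j)) \<Longrightarrow> smooth (\<lambda>x. \<Prod>j\<in>A. F j x)"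
proof (induction rule: finite_induct)
  case (insert j A)
  then show ?case
    using smooth_mult[of "F j" "\<lambda>x. \<Prod>j\<in>A. F j x"] by (simp add: times_fun_def)
qed (simp add: smooth_const)

text \<open>
  \<open>flat n\<close> is the \<open>n\<close>-th derivative of the function that is \<open>exp (- 1 / t)\<close> for \<open>t > 0\<close> and \<open>0\<close>
  otherwise.  The recursion for the polynomials in \<open>1 / t\<close> comes from differentiating
  \<open>p (1 / t) * exp (- 1 / t)\<close>.
\<close>

fun flat_poly :: "nat \<Rightarrow> real poly" where
  "flat_poly 0 = 1"
| "flat_poly (Suc n) = monom 1 2 * (flat_poly n - pderiv (flat_poly n))"

definition flat :: "nat \<Rightarrow> real \<Rightarrow> real" where
  "flat n t = (if t > 0 then poly (flat_poly n) (1 / t) * exp (- (1 / t)) else 0)"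

text \<open>
  The power \<open>s ^ k\<close> makes the induction over the polynomial work; the difference quotient of
  \<open>flat n\<close> at \<open>0\<close> is the case \<open>k = 1\<close> with \<open>s = 1 / t\<close>.
\<close>

lemma poly_exp_tendsto_0: "((\<lambda>s. s ^ k * poly p s * exp (- s)) \<longlongrightarrow> (0 :: real)) at_top"
proof (induction p arbitrary: k)
  case (pCons a p)
  have "((\<lambda>s. a * (s ^ k / exp s) + s ^ Suc k * poly p s * exp (- s)) \<longlongrightarrow> a * 0 + 0) at_top"
    by (intro tendsto_intros tendsto_power_div_exp_0 pCons.IH)
  then show ?case by (simp add: algebra_simps exp_minus divide_inverse)
qed simp

lemma flat_has_derivative: "(flat n has_real_derivative flat (Suc n) t) (at t)"
proof -
  consider "t < 0" | "t = 0" | "t > 0" by linarith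
  then show ?thesis
  proof cases
    case 1
    have "((\<lambda>_. 0) has_real_derivative flat (Suc n) t) (at t)"
      using 1 by (auto simp: flat_def)
    then show ?thesis
      by (rule has_field_derivative_transform_within_open[of _ _ _ "{..<0}"])
        (use 1 in \<open>auto simp: flat_def\<close>)
  next
    case 3
    have "((\<lambda>t. poly (flat_poly n) (1 / t) * exp (- (1 / t))) has_real_derivative flat (Suc n) t) (at t)"
    proof -
      have i: "((\<lambda>t. 1 / t) has_real_derivative - (1 / t ^ 2)) (at t)"
        using 3 by (auto intro!: derivative_eq_intros simp: power2_eq_square)
      have p: "((\<lambda>t. poly (flat_poly n) (1 / t)) has_real_derivative
          poly (pderiv (flat_poly n)) (1 / t) * (- (1 / t ^ 2))) (at t)"
        by (rule DERIV_chain2[OF poly_DERIV i])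
      have e: "((\<lambda>t. exp (- (1 / t))) has_real_derivative exp (- (1 / t)) * (1 / t ^ 2)) (at t)"
        using 3 by (auto intro!: derivative_eq_intros simp: power2_eq_square)
      show ?thesis
        using DERIV_mult[OF p e] 3
        by (simp add: flat_def poly_monom algebra_simps power_divide)
    qed
    then show ?thesis
      by (rule has_field_derivative_transform_within_open[of _ _ _ "{0<..}"])
        (use 3 in \<open>auto simp: flat_def\<close>)
  next
    case 2
    have l: "((\<lambda>y. flat n y / y) \<longlongrightarrow> 0) (at_left 0)"
      by (rule tendsto_eventually)
        (auto simp: flat_def eventually_at_left_field intro!: exI[of _ "-1"])
    have "((\<lambda>y. (inverse y) ^ 1 * poly (flat_poly n) (inverse y) * exp (- inverse y)) \<longlongrightarrow> (0 :: real)) (at_right 0)"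
      by (rule filterlim_compose[OF poly_exp_tendsto_0 filterlim_inverse_at_top_right])
    moreover have "\<forall>\<^sub>F y in at_right 0.
        (inverse y) ^ 1 * poly (flat_poly n) (inverse y) * exp (- inverse y) = flat n y / y"
      by (auto simp: flat_def eventually_at_right_field divide_inverse intro!: exI[of _ 1])
    ultimately have r: "((\<lambda>y. flat n y / y) \<longlongrightarrow> 0) (at_right 0)"
      using tendsto_cong by force
    from l r have "((\<lambda>y. flat n y / y) \<longlongrightarrow> 0) (at 0)"
      by (simp add: filterlim_split_at)
    with 2 show ?thesis by (simp add: has_field_derivative_iff flat_def)
  qed
qed

lemma flat_0_bounds: "0 \<le> flat 0 t" "flat 0 t \<le> 1"
  by (auto simp: flat_def)

lemma flat_0_scaled_tendsto:
  assumes "t > 0"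
  shows "(\<lambda>k. flat 0 (real k * t)) \<longlonglongrightarrow> 1"
proof -
  have "(\<lambda>k. exp (- (inverse (real k) * (1 / t)))) \<longlonglongrightarrow> exp (- (0 * (1 / t)))"
    by (intro tendsto_intros lim_inverse_n)
  moreover have "\<forall>\<^sub>F k in sequentially. exp (- (inverse (real k) * (1 / t))) = flat 0 (real k * t)"
    using eventually_gt_at_top[of 0] by eventually_elim (use assms in \<open>simp add: flat_def field_simps\<close>)
  ultimately show ?thesis using tendsto_cong by force
qed

text \<open>
  Scaling the argument by \<open>k\<close> replaces \<open>exp (- 1 / t)\<close> by its \<open>k\<close>-th root, so that the bumps converge to
  the indicator function of the open interval or box while their support stays fixed.
\<close>

definition interval_bump :: "nat \<Rightarrow> real \<Rightarrow> real \<Rightarrow> real \<Rightarrow> real" where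
  "interval_bump k a b t = flat 0 (real k * (t - a)) * flat 0 (real k * (b - t))"

definition box_bump :: "nat \<Rightarrow> real ^ 'n \<Rightarrow> real ^ 'n \<Rightarrow> real ^ 'n \<Rightarrow> real" where
  "box_bump k a b x = (\<Prod>j\<in>UNIV. interval_bump k (a $ j) (b $ j) (x $ j))"

lemma smooth_interval_bump: "smooth (\<lambda>x :: real ^ 'n. interval_bump k a b (x $ j))"
proof -
  have "smooth ((\<lambda>x :: real ^ 'n. 1 * flat 0 (real k * x $ j + (- real k * a))) *
      (\<lambda>x. 1 * flat 0 (- real k * x $ j + real k * b)))"
    by (intro smooth_mult smooth_coordinate flat_has_derivative)
  then show ?thesis by (simp add: interval_bump_def times_fun_def algebra_simps)
qed

lemma smooth_box_bump: "smooth (box_bump k a b)"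
  unfolding box_bump_def by (intro smooth_prod smooth_interval_bump finite)

lemma interval_bump_bounds: "0 \<le> interval_bump k a b t" "interval_bump k a b t \<le> 1"
  by (auto simp: interval_bump_def flat_0_bounds mult_le_one)

lemma box_bump_bounds: "0 \<le> box_bump k a b x" "box_bump k a b x \<le> 1"
  unfolding box_bump_def by (auto intro: prod_nonneg prod_le_1 interval_bump_bounds)

lemma interval_bump_eq_0: "\<not> (a < t \<and> t < b) \<Longrightarrow> interval_bump k a b t = 0"
  by (auto simp: interval_bump_def flat_def zero_less_mult_iff)

lemma box_bump_eq_0:
  assumes "x \<notin> box a b"
  shows "box_bump k a b x = 0"
proof -
  obtain j where "\<not> (a $ j < x $ j \<and> x $ j < b $ j)"
    using assms by (auto simp: mem_box_cart)
  then show ?thesis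
    unfolding box_bump_def by (intro prod_zero bexI[of _ j]) (auto intro: interval_bump_eq_0)
qed

lemma interval_bump_tendsto:
  assumes "a < t" "t < b"
  shows "(\<lambda>k. interval_bump k a b t) \<longlonglongrightarrow> 1"
  unfolding interval_bump_def
  using tendsto_mult[OF flat_0_scaled_tendsto flat_0_scaled_tendsto, of "t - a" "b - t"] assms
  by simp

lemma box_bump_tendsto: "(\<lambda>k. box_bump k a b x) \<longlonglongrightarrow> indicator (box a b) x"
proof (cases "x \<in> box a b")
  case True
  then have "(\<lambda>k. box_bump k a b x) \<longlonglongrightarrow> (\<Prod>j\<in>(UNIV :: 'a set). 1)"
    unfolding box_bump_def by (intro tendsto_prod interval_bump_tendsto) (auto simp: mem_box_cart)
  with True show ?thesis by simp
qed (simp add: box_bump_eq_0)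

section \<open>The fundamental lemma of the calculus of variations\<close>

text \<open>
  By Henstock's lemma the Riemann sums of \<open>f\<close> over fine tagged divisions are close to the integrals of
  \<open>f\<close> term by term, in absolute value.  Since these integrals are zero, the Riemann sums of \<open>\<bar>f\<bar>\<close> are
  small, hence \<open>\<bar>f\<bar>\<close> has integral zero.
\<close>

lemma AE_zero_on_cbox:
  fixes f :: "'a::euclidean_space \<Rightarrow> real"
  assumes f: "f absolutely_integrable_on cbox c d"
    and zero: "\<And>a b. cbox a b \<subseteq> cbox c d \<Longrightarrow> integral (cbox a b) f = 0"
  shows "AE x in lebesgue. x \<in> cbox c d \<longrightarrow> f x = 0"
proof -
  have "((\<lambda>x. \<bar>f x\<bar>) has_integral 0) (cbox c d)"
    unfolding has_integral
  proof (intro allI impI)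
    fix e :: real assume "e > 0"
    have int: "f integrable_on cbox c d"
      using f by (rule set_lebesgue_integral_eq_integral(1))
    have "\<exists>\<gamma>. gauge \<gamma> \<and> (\<forall>p. p tagged_partial_division_of cbox c d \<longrightarrow> \<gamma> fine p \<longrightarrow>
             (\<Sum>(x,k)\<in>p. norm (measure lborel k *\<^sub>R f x - integral k f)) < e)"
      by (rule Henstock_lemma[OF int \<open>e > 0\<close>]) (rule exI, rule conjI, assumption, intro allI impI, simp)
    then obtain \<gamma> where \<gamma>: "gauge \<gamma>"
      and less: "\<And>p. p tagged_partial_division_of cbox c d \<Longrightarrow> \<gamma> fine p \<Longrightarrow>
             (\<Sum>(x,k)\<in>p. norm (measure lborel k *\<^sub>R f x - integral k f)) < e"
      by blast
    have fine: "norm ((\<Sum>(x,k)\<in>p. measure lborel k *\<^sub>R \<bar>f x\<bar>) - 0) < e"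
      if p: "p tagged_division_of cbox c d" "\<gamma> fine p" for p
    proof -
      have "(\<Sum>(x,k)\<in>p. measure lborel k *\<^sub>R \<bar>f x\<bar>) = (\<Sum>(x,k)\<in>p. norm (measure lborel k *\<^sub>R f x - integral k f))"
      proof (rule sum.cong[OF refl], clarify)
        fix x k assume xk: "(x, k) \<in> p"
        obtain a b where "k = cbox a b" using tagged_division_ofD(4)[OF p(1) xk] by blast
        moreover have "k \<subseteq> cbox c d" using tagged_division_ofD(3)[OF p(1) xk] .
        ultimately have "integral k f = 0" using zero by blast
        then show "measure lborel k *\<^sub>R \<bar>f x\<bar> = norm (measure lborel k *\<^sub>R f x - integral k f)"
          by (simp add: abs_mult)
      qed
      moreover have "\<dots> < e" using less[OF tagged_division_of_def[THEN iffD1, THEN conjunct1, OF p(1)] p(2)] .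
      moreover have "0 \<le> (\<Sum>(x,k)\<in>p. measure lborel k *\<^sub>R \<bar>f x\<bar>)" by (auto intro!: sum_nonneg)
      ultimately show ?thesis by simp
    qed
    show "\<exists>\<gamma>. gauge \<gamma> \<and> (\<forall>p. p tagged_division_of cbox c d \<and> \<gamma> fine p \<longrightarrow>
        norm ((\<Sum>(x,k)\<in>p. measure lborel k *\<^sub>R \<bar>f x\<bar>) - 0) < e)"
      by (intro exI[of _ \<gamma>] conjI allI impI \<gamma>, rule fine) auto
  qed
  then have "integral (cbox c d) (\<lambda>x. \<bar>f x\<bar>) = 0" by (rule integral_unique)
  moreover have abs: "(\<lambda>x. \<bar>f x\<bar>) absolutely_integrable_on cbox c d"
    using absolutely_integrable_norm[OF f] by (simp add: o_def)
  ultimately have "(LINT x : cbox c d | lebesgue. \<bar>f x\<bar>) = 0"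
    by (simp add: set_lebesgue_integral_eq_integral(2))
  then have "AE x in lebesgue. indicator (cbox c d) x *\<^sub>R \<bar>f x\<bar> = 0"
    using abs unfolding set_lebesgue_integral_def set_integrable_def
    by (subst (asm) integral_nonneg_eq_0_iff_AE) auto
  then show ?thesis by eventually_elim (auto simp: indicator_def)
qed

text \<open>
  The fundamental lemma of the calculus of variations.  Dominated convergence passes from the bumps to
  the indicator functions of boxes, so \<open>r\<close> integrates to zero over every box inside \<open>\<Omega>\<close>; and \<open>\<Omega>\<close> is a
  countable union of boxes.
\<close>

lemma AE_zero_if_orthogonal_to_box_bumps:
  fixes r :: "real ^ 'n \<Rightarrow> real"
  assumes \<Omega>: "open \<Omega>" "bounded \<Omega>" and r: "r \<in> L2 \<Omega>"
    and orth: "\<And>k a b. cbox a b \<subseteq> \<Omega> \<Longrightarrow> L2_inner \<Omega> r (box_bump k a b) = 0"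
  shows "AE x in lebesgue_on \<Omega>. r x = 0"
proof -
  have r1: "integrable (lebesgue_on \<Omega>) r"
    using integrable_L2_product[OF r continuous_on_bounded_open_in_L2[OF \<Omega>, of "\<lambda>_. 1"]] by simp
  have meas: "\<Omega> \<in> sets lebesgue" using \<Omega> by auto
  have r2: "integrable lebesgue (\<lambda>x. indicator \<Omega> x *\<^sub>R r x)"
    using r1 meas by (simp add: integrable_restrict_space)
  have sub: "r absolutely_integrable_on S" if "S \<subseteq> \<Omega>" "S \<in> sets lebesgue" for S
    using set_integrable_subset[of lebesgue \<Omega> r S] r2 that by (simp add: set_integrable_def)
  have box0: "integral (cbox a b) r = 0" if ab: "cbox a b \<subseteq> \<Omega>" for a b
  proof -
    have "(\<lambda>k. \<integral>x. r x * box_bump k a b x \<partial>lebesgue_on \<Omega>)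
        \<longlonglongrightarrow> (\<integral>x. r x * indicator (box a b) x \<partial>lebesgue_on \<Omega>)"
    proof (rule integral_dominated_convergence)
      show "integrable (lebesgue_on \<Omega>) (\<lambda>x. \<bar>r x\<bar>)" using r1 by simp
      show "(\<lambda>x. r x * indicator (box a b) x) \<in> borel_measurable (lebesgue_on \<Omega>)"
        using r1 by (intro borel_measurable_times measurable_restrict_space1[OF borel_measurable_indicator]
            borel_measurable_integrable) auto
      show "(\<lambda>x. r x * box_bump k a b x) \<in> borel_measurable (lebesgue_on \<Omega>)" for k
        using r1 continuous_on_bounded_open_in_L2[OF \<Omega> smooth_continuous_on[OF smooth_box_bump[of k a b]]]
        by (auto simp: L2_def)
      show "AE x in lebesgue_on \<Omega>. (\<lambda>k. r x * box_bump k a b x) \<longlonglongrightarrow> r x * indicator (box a b) x"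
        by (intro AE_I2 tendsto_intros box_bump_tendsto)
      show "AE x in lebesgue_on \<Omega>. norm (r x * box_bump k a b x) \<le> \<bar>r x\<bar>" for k
        using box_bump_bounds[of k a b]
        by (intro AE_I2) (simp add: abs_mult mult_left_le)
    qed
    then have "(\<integral>x. r x * indicator (box a b) x \<partial>lebesgue_on \<Omega>) = 0"
      using orth[OF ab] by (simp add: L2_inner_def LIMSEQ_const_iff)
    then have "(\<integral>x. indicator \<Omega> x *\<^sub>R (r x * indicator (box a b) x) \<partial>lebesgue) = 0"
      using meas by (simp add: integral_restrict_space)
    also have "(\<lambda>x. indicator \<Omega> x *\<^sub>R (r x * indicator (box a b) x)) = (\<lambda>x. indicator (box a b) x *\<^sub>R r x)"
      using subsetD[OF ab subsetD[OF box_subset_cbox[of a b]]] by (auto simp: fun_eq_iff indicator_def)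
    finally have "(LINT x : box a b | lebesgue. r x) = 0" by (simp add: set_lebesgue_integral_def)
    moreover have "r absolutely_integrable_on box a b"
      using sub ab box_subset_cbox[of a b] by auto
    ultimately have "integral (box a b) r = 0"
      by (simp add: set_lebesgue_integral_eq_integral(2))
    then show ?thesis by (simp add: integral_open_interval)
  qed
  obtain \<D> where \<D>: "countable \<D>" "\<D> \<subseteq> Pow \<Omega>" "\<And>X. X \<in> \<D> \<Longrightarrow> \<exists>a b. X = cbox a b" "\<Union>\<D> = \<Omega>"
    using open_countable_Union_open_cbox[OF \<Omega>(1)] by metis
  have "AE x in lebesgue. x \<in> X \<longrightarrow> r x = 0" if X\<D>: "X \<in> \<D>" for X
  proof -
    obtain a b where X: "X = cbox a b" using \<D>(3)[OF X\<D>] by blast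
    have cb: "cbox a b \<subseteq> \<Omega>" using X \<D>(2) X\<D> by blast
    show ?thesis
      unfolding X by (rule AE_zero_on_cbox[OF sub[OF cb] box0[OF order_trans[OF _ cb]]]) simp
  qed
  then have "AE x in lebesgue. \<forall>X\<in>\<D>. x \<in> X \<longrightarrow> r x = 0"
    by (subst AE_ball_countable[OF \<D>(1)]) (rule ballI)
  then show ?thesis
  proof -
    have "AE x in lebesgue. x \<in> \<Omega> \<longrightarrow> r x = 0"
      using \<open>AE x in lebesgue. \<forall>X\<in>\<D>. x \<in> X \<longrightarrow> r x = 0\<close>
      by eventually_elim (use \<D>(4) in blast)
    with meas show ?thesis by (simp add: AE_restrict_space_iff)
  qed
qed

section \<open>Test functions and integration by parts\<close>

lemma partial_eq_0_outside_support:
  assumes "closed K" "\<And>x. x \<notin> K \<Longrightarrow> \<phi> x = 0" "x \<notin> K"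
  shows "partial i \<phi> x = 0"
proof -
  have "((\<lambda>_. 0) has_derivative (\<lambda>_. 0)) (at x)" by simp
  then have "(\<phi> has_derivative (\<lambda>_. 0)) (at x)"
    by (rule has_derivative_transform_within_open[of _ _ _ _ "- K"]) (use assms in auto)
  then show ?thesis by (rule partial_has_derivative)
qed

lemma test_functions_smooth: "\<phi> \<in> test_functions \<Omega> \<Longrightarrow> smooth \<phi>"
  by (simp add: test_functions_def)

lemma test_functions_partial:
  assumes "\<phi> \<in> test_functions \<Omega>"
  shows "partial i \<phi> \<in> test_functions \<Omega>"
proof -
  obtain K where K: "compact K" "K \<subseteq> \<Omega>" "\<And>x. x \<notin> K \<Longrightarrow> \<phi> x = 0"
    using assms by (auto simp: test_functions_def)
  have "\<forall>x. x \<notin> K \<longrightarrow> partial i \<phi> x = 0"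
    using partial_eq_0_outside_support[OF compact_imp_closed[OF K(1)], of \<phi> _ i] K(3) by blast
  with K(1,2) show ?thesis
    unfolding test_functions_def using smooth_partial[OF test_functions_smooth[OF assms]] by blast
qed

lemma test_functions_smooth_mult:
  "smooth f \<Longrightarrow> \<phi> \<in> test_functions \<Omega> \<Longrightarrow> f * \<phi> \<in> test_functions \<Omega>"
  unfolding test_functions_def using smooth_mult[of f \<phi>] by (auto simp: times_fun_def)

lemma test_functions_add:
  assumes "\<phi> \<in> test_functions \<Omega>" "\<psi> \<in> test_functions \<Omega>"
  shows "\<phi> + \<psi> \<in> test_functions \<Omega>"
proof -
  obtain K L where K: "compact K" "K \<subseteq> \<Omega>" "\<And>x. x \<notin> K \<Longrightarrow> \<phi> x = 0"
    and L: "compact L" "L \<subseteq> \<Omega>" "\<And>x. x \<notin> L \<Longrightarrow> \<psi> x = 0"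
    using assms unfolding test_functions_def by blast
  have "smooth (\<phi> + \<psi>)"
  proof (rule smooth_product_sum_smooth, rule smooth_product_sum.sum)
    have one: "(\<lambda>x. 1 :: real) * h = h" for h :: "real ^ 'a \<Rightarrow> real" by (simp add: times_fun_def)
    have "smooth_product_sum h" if "smooth h" for h :: "real ^ 'a \<Rightarrow> real"
      using smooth_product_sum.product[OF smooth_const[of 1] that] unfolding one .
    then show "smooth_product_sum \<phi>" "smooth_product_sum \<psi>"
      using assms by (auto intro: test_functions_smooth)
  qed
  moreover have "compact (K \<union> L)" "K \<union> L \<subseteq> \<Omega>" using K L by auto
  moreover have "\<forall>x. x \<notin> K \<union> L \<longrightarrow> (\<phi> + \<psi>) x = 0" using K L by simp
  ultimately show ?thesis unfolding test_functions_def by blast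
qed

lemma test_functions_scaleR: "\<phi> \<in> test_functions \<Omega> \<Longrightarrow> c *\<^sub>R \<phi> \<in> test_functions \<Omega>"
  using test_functions_smooth_mult[OF smooth_const[of c]] by (simp add: times_fun_def scaleR_fun_def)

lemma test_functions_zero: "0 \<in> test_functions \<Omega>"
  using smooth_const[of 0] by (auto simp: test_functions_def zero_fun_def intro!: exI[of _ "{}"])

lemma box_bump_test_function:
  assumes "cbox a b \<subseteq> \<Omega>"
  shows "box_bump k a b \<in> test_functions \<Omega>"
proof -
  have "\<forall>x. x \<notin> cbox a b \<longrightarrow> box_bump k a b x = 0"
    using box_bump_eq_0 box_subset_cbox by blast
  then show ?thesis
    unfolding test_functions_def mem_Collect_eq
    using assms by (intro conjI smooth_box_bump exI[of _ "cbox a b"] compact_cbox)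
qed

lemma smooth_directional_derivative:
  assumes "smooth \<phi>"
  shows "((\<lambda>t. \<phi> (x + t *\<^sub>R axis i 1)) has_real_derivative partial i \<phi> (x + t *\<^sub>R axis i 1)) (at t)"
proof -
  let ?D = "frechet_derivative \<phi> (at (x + t *\<^sub>R axis i 1))"
  have "((\<lambda>t. x + t *\<^sub>R axis i 1) has_derivative (\<lambda>h. h *\<^sub>R axis i 1)) (at t)"
    by (auto intro!: derivative_eq_intros)
  from has_derivative_compose[OF this smooth_has_derivative[OF assms]]
  have "((\<lambda>t. \<phi> (x + t *\<^sub>R axis i 1)) has_derivative (\<lambda>h. ?D (h *\<^sub>R axis i 1))) (at t)" .
  moreover have "(\<lambda>h. ?D (h *\<^sub>R axis i 1)) = (*) (partial i \<phi> (x + t *\<^sub>R axis i 1))"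
    using linear_frechet_derivative[OF smooth_differentiable[OF assms]]
    by (auto simp: fun_eq_iff partial_def linear_cmul)
  ultimately show ?thesis by (simp add: has_field_derivative_def)
qed

lemma lborel_integral_translation:
  fixes f :: "'a::euclidean_space \<Rightarrow> real"
  assumes "f \<in> borel_measurable borel"
  shows "(\<integral>x. f (x + c) \<partial>lborel) = (\<integral>x. f x \<partial>lborel)"
proof -
  have "(\<integral>x. f x \<partial>lborel) = (\<integral>x. f x \<partial>distr lborel borel ((+) c))"
    by (simp add: lborel_distr_plus)
  also have "\<dots> = (\<integral>x. f (c + x) \<partial>lborel)"
    using assms by (intro integral_distr) auto
  finally show ?thesis by (simp add: add.commute)
qed

lemma integrable_compactly_supported:
  fixes f :: "'a::euclidean_space \<Rightarrow> real"
  assumes "continuous_on UNIV f" "compact K" "\<And>x. x \<notin> K \<Longrightarrow> f x = 0"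
  shows "integrable lborel f"
proof -
  have "integrable lborel (\<lambda>x. indicator K x *\<^sub>R f x)"
    using assms by (intro borel_integrable_compact) (auto intro: continuous_on_subset)
  also have "(\<lambda>x. indicator K x *\<^sub>R f x) = f"
    using assms(3) by (auto simp: fun_eq_iff indicator_def)
  finally show ?thesis .
qed

text \<open>
  The difference quotients of \<open>\<phi>\<close> have integral zero because Lebesgue measure is invariant under
  translations.  They converge to the partial derivative and are dominated, by the mean value theorem,
  by a constant on a ball.
\<close>

lemma lborel_integral_partial_eq_0:
  fixes \<phi> :: "real ^ 'n \<Rightarrow> real"
  assumes sm: "smooth \<phi>" and K: "compact K" "\<And>x. x \<notin> K \<Longrightarrow> \<phi> x = 0"
  shows "(\<integral>x. partial i \<phi> x \<partial>lborel) = 0"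
proof -
  define e where "e = (axis i 1 :: real ^ 'n)"
  have e: "norm e = 1" by (simp add: e_def)
  have cont: "continuous_on UNIV \<phi>" "continuous_on UNIV (partial i \<phi>)"
    using sm by (auto intro: smooth_continuous_on smooth_partial)
  have meas: "\<phi> \<in> borel_measurable borel" "partial i \<phi> \<in> borel_measurable borel"
    using cont by (auto intro: borel_measurable_continuous_onI)
  have K': "partial i \<phi> x = 0" if "x \<notin> K" for x
    using partial_eq_0_outside_support[OF compact_imp_closed[OF K(1)] K(2) that] .
  obtain R where R: "\<And>x. x \<in> K \<Longrightarrow> norm x \<le> R"
    using compact_imp_bounded[OF K(1)] bounded_iff by metis
  have "compact (partial i \<phi> ` K)"
    using K(1) cont(2) by (intro compact_continuous_image) (auto intro: continuous_on_subset)
  then obtain B0 where B0: "\<And>x. x \<in> K \<Longrightarrow> \<bar>partial i \<phi> x\<bar> \<le> B0"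
    using compact_imp_bounded bounded_iff by (metis imageI real_norm_def)
  \<comment> \<open>\<open>K\<close> may be empty, and then \<open>B0\<close> may be negative.\<close>
  define B where "B = max B0 0"
  have B: "\<bar>partial i \<phi> x\<bar> \<le> B" for x
    using B0[of x] K'[of x] by (cases "x \<in> K") (auto simp: B_def)
  have der: "((\<lambda>t. \<phi> (x + t *\<^sub>R e)) has_real_derivative partial i \<phi> (x + t *\<^sub>R e)) (at t)" for x t
    unfolding e_def by (rule smooth_directional_derivative[OF sm])
  \<comment> \<open>The step is at most \<open>1\<close>, so \<open>s n\<close> vanishes outside the ball of radius \<open>R + 1\<close>.\<close>
  define s where "s n x = (\<phi> (x + (1 / real (Suc n)) *\<^sub>R e) - \<phi> x) / (1 / real (Suc n))" for n x
  have bound: "\<bar>s n x\<bar> \<le> indicator (cball 0 (R + 1)) x *\<^sub>R B" for n x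
  proof (cases "x \<in> cball 0 (R + 1)")
    case True
    obtain z where z: "\<phi> (x + (1 / real (Suc n)) *\<^sub>R e) - \<phi> (x + 0 *\<^sub>R e)
        = (1 / real (Suc n) - 0) * partial i \<phi> (x + z *\<^sub>R e)"
      using MVT2[of 0 "1 / real (Suc n)", OF _ der] by auto
    then have "s n x = partial i \<phi> (x + z *\<^sub>R e)" by (simp add: s_def)
    with True B show ?thesis by simp
  next
    case False
    then have x: "norm x > R + 1" by (simp add: dist_norm)
    have "norm x \<le> norm (x + (1 / real (Suc n)) *\<^sub>R e) + norm ((1 / real (Suc n)) *\<^sub>R e)"
      by (metis norm_triangle_ineq4 add_diff_cancel_right')
    also have "norm ((1 / real (Suc n)) *\<^sub>R e) \<le> 1" using e by simp
    finally have "norm (x + (1 / real (Suc n)) *\<^sub>R e) > R" using x by simp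
    then have "\<phi> (x + (1 / real (Suc n)) *\<^sub>R e) = 0" "\<phi> x = 0"
      using R K(2) x by force+
    with False show ?thesis by (simp add: s_def)
  qed
  have lim: "(\<lambda>n. s n x) \<longlonglongrightarrow> partial i \<phi> x" for x
  proof -
    have "((\<lambda>h. (\<phi> (x + (0 + h) *\<^sub>R e) - \<phi> (x + 0 *\<^sub>R e)) / h) \<longlongrightarrow> partial i \<phi> (x + 0 *\<^sub>R e)) (at 0)"
      using der[of x 0] unfolding DERIV_def .
    moreover have "filterlim (\<lambda>n. 1 / real (Suc n)) (at 0) sequentially"
      using LIMSEQ_inverse_real_of_nat by (auto simp: filterlim_at divide_inverse)
    ultimately show ?thesis
      using filterlim_compose[of _ _ "at 0" "\<lambda>n. 1 / real (Suc n)"] by (fastforce simp: s_def)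
  qed
  have int: "integrable lborel \<phi>" by (rule integrable_compactly_supported[OF cont(1) K])
  have int': "integrable lborel (\<lambda>x. \<phi> (x + c))" for c
  proof (rule integrable_compactly_supported)
    show "continuous_on UNIV (\<lambda>x. \<phi> (x + c))"
      by (intro continuous_on_compose2[OF cont(1)] continuous_intros) auto
    show "compact ((\<lambda>x. - c + x) ` K)" using K(1) by (rule compact_translation)
    show "\<phi> (x + c) = 0" if "x \<notin> (\<lambda>x. - c + x) ` K" for x
      using that by (intro K(2)) (force simp: image_iff)
  qed
  have "(\<integral>x. s n x \<partial>lborel) = 0" for n
    unfolding s_def using int int' lborel_integral_translation[OF meas(1)]
    by (simp add: Bochner_Integration.integral_diff)
  moreover have "(\<lambda>n. \<integral>x. s n x \<partial>lborel) \<longlonglongrightarrow> (\<integral>x. partial i \<phi> x \<partial>lborel)"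
  proof (rule integral_dominated_convergence)
    show "integrable lborel (\<lambda>x. indicator (cball 0 (R + 1)) x *\<^sub>R B)"
      by (intro borel_integrable_compact) auto
    show "s n \<in> borel_measurable lborel" for n
      unfolding s_def using int' int by (intro borel_measurable_divide borel_measurable_diff) auto
  qed (use meas lim bound in auto)
  ultimately show ?thesis by (simp add: LIMSEQ_const_iff)
qed

locale bounded_open =
  fixes \<Omega> :: "(real ^ 'n) set"
  assumes open_domain: "open \<Omega>" and bounded_domain: "bounded \<Omega>"
begin

lemma smooth_in_L2: "smooth f \<Longrightarrow> f \<in> L2 \<Omega>"
  by (rule continuous_on_bounded_open_in_L2[OF open_domain bounded_domain smooth_continuous_on])

lemma test_function_in_L2: "\<phi> \<in> test_functions \<Omega> \<Longrightarrow> \<phi> \<in> L2 \<Omega>"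
  by (rule smooth_in_L2[OF test_functions_smooth])

lemma partial_test_function_in_L2: "\<phi> \<in> test_functions \<Omega> \<Longrightarrow> partial i \<phi> \<in> L2 \<Omega>"
  by (rule test_function_in_L2[OF test_functions_partial])

lemma integral_partial_test_function_eq_0:
  assumes "\<phi> \<in> test_functions \<Omega>"
  shows "(\<integral>x. partial i \<phi> x \<partial>lebesgue_on \<Omega>) = 0"
proof -
  obtain K where K: "compact K" "K \<subseteq> \<Omega>" "\<And>x. x \<notin> K \<Longrightarrow> \<phi> x = 0"
    using assms by (auto simp: test_functions_def)
  have sm: "smooth \<phi>" using assms by (rule test_functions_smooth)
  have "(\<integral>x. partial i \<phi> x \<partial>lebesgue_on \<Omega>) = (\<integral>x. indicator \<Omega> x *\<^sub>R partial i \<phi> x \<partial>lebesgue)"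
    using open_domain by (intro integral_restrict_space) auto
  also have "(\<lambda>x. indicator \<Omega> x *\<^sub>R partial i \<phi> x) = partial i \<phi>"
  proof
    fix x
    have "partial i \<phi> x = 0" if "x \<notin> \<Omega>"
      using partial_eq_0_outside_support[OF compact_imp_closed[OF K(1)], of \<phi> x i] K that by blast
    then show "indicator \<Omega> x *\<^sub>R partial i \<phi> x = partial i \<phi> x" by (cases "x \<in> \<Omega>") auto
  qed
  also have "(\<integral>x. partial i \<phi> x \<partial>lebesgue) = (\<integral>x. partial i \<phi> x \<partial>lborel)"
    using smooth_continuous_on[OF smooth_partial[OF sm]]
    by (intro integral_completion) (auto intro: borel_measurable_continuous_onI)
  also have "\<dots> = 0" by (rule lborel_integral_partial_eq_0[OF sm K(1,3)])
  finally show ?thesis .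
qed

lemma integration_by_parts:
  assumes f: "smooth f" and \<phi>: "\<phi> \<in> test_functions \<Omega>"
  shows "L2_inner \<Omega> f (partial i \<phi>) = - L2_inner \<Omega> (partial i f) \<phi>"
proof -
  have "partial i (f * \<phi>) = f * partial i \<phi> + partial i f * \<phi>"
    by (intro partial_mult smooth_differentiable f test_functions_smooth[OF \<phi>])
  then have "(\<integral>x. f x * partial i \<phi> x + partial i f x * \<phi> x \<partial>lebesgue_on \<Omega>) = 0"
    using integral_partial_test_function_eq_0[OF test_functions_smooth_mult[OF f \<phi>], of i] by simp
  then show ?thesis
    using integrable_L2_product[OF smooth_in_L2[OF f] partial_test_function_in_L2[OF \<phi>, of i]]
      integrable_L2_product[OF smooth_in_L2[OF smooth_partial[OF f], of i] test_function_in_L2[OF \<phi>]]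
    by (simp add: L2_inner_def)
qed

section \<open>Weak gradients and the space of functions with zero trace\<close>

lemma AE_zero_if_orthogonal_to_test_functions:
  assumes "r \<in> L2 \<Omega>" "\<And>\<phi>. \<phi> \<in> test_functions \<Omega> \<Longrightarrow> L2_inner \<Omega> r \<phi> = 0"
  shows "AE x in lebesgue_on \<Omega>. r x = 0"
  by (rule AE_zero_if_orthogonal_to_box_bumps[OF open_domain bounded_domain assms(1)])
    (rule assms(2), rule box_bump_test_function)

lemma is_weak_gradientD:
  assumes "is_weak_gradient \<Omega> u p"
  shows "p \<in> L2 \<Omega>"
    and "\<phi> \<in> test_functions \<Omega> \<Longrightarrow> L2_inner \<Omega> u (partial i \<phi>) = - L2_inner \<Omega> (\<lambda>x. p x $ i) \<phi>"
  using assms unfolding is_weak_gradient_def by blast+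

text \<open>
  This makes \<open>grad\<close>, a choice of representative, linear up to null sets.
\<close>

lemma weak_gradient_unique:
  assumes p: "is_weak_gradient \<Omega> u p" and q: "is_weak_gradient \<Omega> u q"
  shows "AE x in lebesgue_on \<Omega>. p x = q x"
proof -
  note L = is_weak_gradientD(1)[OF p] is_weak_gradientD(1)[OF q]
  have "AE x in lebesgue_on \<Omega>. ((\<lambda>x. p x $ i) - (\<lambda>x. q x $ i)) x = 0" for i
  proof (rule AE_zero_if_orthogonal_to_test_functions)
    show "(\<lambda>x. p x $ i) - (\<lambda>x. q x $ i) \<in> L2 \<Omega>" by (intro L2_diff L2_component L)
    show "L2_inner \<Omega> ((\<lambda>x. p x $ i) - (\<lambda>x. q x $ i)) \<phi> = 0" if \<phi>: "\<phi> \<in> test_functions \<Omega>" for \<phi>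
      using is_weak_gradientD(2)[OF p \<phi>, of i] is_weak_gradientD(2)[OF q \<phi>, of i]
      by (simp add: L2_inner_diff_left L2_component L test_function_in_L2[OF \<phi>])
  qed
  then have "AE x in lebesgue_on \<Omega>. \<forall>i\<in>UNIV. ((\<lambda>x. p x $ i) - (\<lambda>x. q x $ i)) x = 0"
    by (intro AE_finite_allI) auto
  then show ?thesis by eventually_elim (simp add: vec_eq_iff)
qed

lemma weak_gradient_add:
  assumes "u \<in> L2 \<Omega>" "v \<in> L2 \<Omega>" and p: "is_weak_gradient \<Omega> u p" and q: "is_weak_gradient \<Omega> v q"
  shows "is_weak_gradient \<Omega> (u + v) (p + q)"
  unfolding is_weak_gradient_def
proof (intro conjI ballI allI)
  note L = is_weak_gradientD(1)[OF p] is_weak_gradientD(1)[OF q]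
  show "p + q \<in> L2 \<Omega>" by (rule L2_add[OF L])
  fix \<phi> i assume \<phi>: "\<phi> \<in> test_functions \<Omega>"
  have "(\<lambda>x. (p + q) x $ i) = (\<lambda>x. p x $ i) + (\<lambda>x. q x $ i)" by (simp add: fun_eq_iff)
  then show "L2_inner \<Omega> (u + v) (partial i \<phi>) = - L2_inner \<Omega> (\<lambda>x. (p + q) x $ i) \<phi>"
    using is_weak_gradientD(2)[OF p \<phi>, of i] is_weak_gradientD(2)[OF q \<phi>, of i] L assms(1,2)
    by (simp add: L2_inner_add_left L2_component test_function_in_L2[OF \<phi>]
        partial_test_function_in_L2[OF \<phi>])
qed

lemma weak_gradient_scaleR:
  assumes "is_weak_gradient \<Omega> u p"
  shows "is_weak_gradient \<Omega> (c *\<^sub>R u) (c *\<^sub>R p)"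
  unfolding is_weak_gradient_def
proof (intro conjI ballI allI)
  show "c *\<^sub>R p \<in> L2 \<Omega>" by (rule L2_scaleR[OF is_weak_gradientD(1)[OF assms]])
  fix \<phi> i assume \<phi>: "\<phi> \<in> test_functions \<Omega>"
  have "(\<lambda>x. (c *\<^sub>R p) x $ i) = c *\<^sub>R (\<lambda>x. p x $ i)" by (simp add: fun_eq_iff scaleR_fun_def)
  then show "L2_inner \<Omega> (c *\<^sub>R u) (partial i \<phi>) = - L2_inner \<Omega> (\<lambda>x. (c *\<^sub>R p) x $ i) \<phi>"
    using is_weak_gradientD(2)[OF assms \<phi>, of i] by (simp add: L2_inner_scaleR_left)
qed

lemma weak_gradient_test_function:
  assumes \<phi>: "\<phi> \<in> test_functions \<Omega>"
  shows "is_weak_gradient \<Omega> \<phi> (\<lambda>x. \<chi> i. partial i \<phi> x)"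
  unfolding is_weak_gradient_def
proof (intro conjI ballI allI)
  show "(\<lambda>x. \<chi> i. partial i \<phi> x) \<in> L2 \<Omega>"
    using open_domain bounded_domain smooth_continuous_on[OF test_functions_smooth[OF test_functions_partial[OF \<phi>]]]
    by (intro continuous_on_bounded_open_in_L2 continuous_on_vec_lambda)
  show "L2_inner \<Omega> \<phi> (partial i \<psi>) = - L2_inner \<Omega> (\<lambda>x. (\<chi> i. partial i \<phi> x) $ i) \<psi>"
    if "\<psi> \<in> test_functions \<Omega>" for \<psi> i
    using integration_by_parts[OF test_functions_smooth[OF \<phi>] that, of i] by simp
qed

lemma H1_in_L2: "u \<in> H1 \<Omega> \<Longrightarrow> u \<in> L2 \<Omega>"
  by (simp add: H1_def)

lemma is_weak_gradient_grad: "u \<in> H1 \<Omega> \<Longrightarrow> is_weak_gradient \<Omega> u (grad \<Omega> u)"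
  unfolding grad_def H1_def by (blast intro: someI_ex[of "is_weak_gradient \<Omega> u"])

lemma grad_in_L2: "u \<in> H1 \<Omega> \<Longrightarrow> grad \<Omega> u \<in> L2 \<Omega>"
  by (rule is_weak_gradientD(1)[OF is_weak_gradient_grad])

lemma grad_AE_eq:
  assumes "is_weak_gradient \<Omega> u p"
  shows "AE x in lebesgue_on \<Omega>. grad \<Omega> u x = p x"
  using assms weak_gradient_unique[of u "grad \<Omega> u" p] someI[of "is_weak_gradient \<Omega> u" p]
  by (simp add: grad_def)

lemma H1_add: "u \<in> H1 \<Omega> \<Longrightarrow> v \<in> H1 \<Omega> \<Longrightarrow> u + v \<in> H1 \<Omega>"
  unfolding H1_def using weak_gradient_add L2_add by blast

lemma H1_scaleR: "u \<in> H1 \<Omega> \<Longrightarrow> c *\<^sub>R u \<in> H1 \<Omega>"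
  unfolding H1_def using weak_gradient_scaleR L2_scaleR by blast

lemma H1_diff: "u \<in> H1 \<Omega> \<Longrightarrow> v \<in> H1 \<Omega> \<Longrightarrow> u - v \<in> H1 \<Omega>"
  using H1_add[of u "(-1) *\<^sub>R v"] H1_scaleR[of v "-1"] by simp

lemma test_function_in_H1: "\<phi> \<in> test_functions \<Omega> \<Longrightarrow> \<phi> \<in> H1 \<Omega>"
  unfolding H1_def using weak_gradient_test_function test_function_in_L2 by blast

lemma grad_add:
  "u \<in> H1 \<Omega> \<Longrightarrow> v \<in> H1 \<Omega> \<Longrightarrow> AE x in lebesgue_on \<Omega>. grad \<Omega> (u + v) x = (grad \<Omega> u + grad \<Omega> v) x"
  by (intro grad_AE_eq weak_gradient_add is_weak_gradient_grad H1_in_L2)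

lemma grad_scaleR:
  "u \<in> H1 \<Omega> \<Longrightarrow> AE x in lebesgue_on \<Omega>. grad \<Omega> (c *\<^sub>R u) x = (c *\<^sub>R grad \<Omega> u) x"
  by (intro grad_AE_eq weak_gradient_scaleR is_weak_gradient_grad)

lemma grad_diff:
  assumes "u \<in> H1 \<Omega>" "v \<in> H1 \<Omega>"
  shows "AE x in lebesgue_on \<Omega>. grad \<Omega> (u - v) x = (grad \<Omega> u - grad \<Omega> v) x"
  using grad_add[OF assms(1) H1_scaleR[OF assms(2), of "-1"]] grad_scaleR[OF assms(2), of "-1"]
  by eventually_elim simp

lemma L2_norm_le_H1_norm: "L2_norm \<Omega> u \<le> H1_norm \<Omega> u"
  by (simp add: H1_norm_def real_le_rsqrt)

lemma L2_norm_grad_le_H1_norm: "L2_norm \<Omega> (grad \<Omega> u) \<le> H1_norm \<Omega> u"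
  by (simp add: H1_norm_def real_le_rsqrt)

lemma H1_norm_nonneg: "0 \<le> H1_norm \<Omega> u"
  by (simp add: H1_norm_def)

text \<open>
  The norm of \<open>H\<^sup>1(\<Omega>)\<close> is the Euclidean norm of a pair of \<open>L\<^sup>2\<close> norms.
\<close>

lemma H1_norm_triangle:
  assumes u: "u \<in> H1 \<Omega>" and v: "v \<in> H1 \<Omega>"
  shows "H1_norm \<Omega> (u + v) \<le> H1_norm \<Omega> u + H1_norm \<Omega> v"
proof -
  have "L2_norm \<Omega> (grad \<Omega> (u + v)) = L2_norm \<Omega> (grad \<Omega> u + grad \<Omega> v)"
    using u v by (intro L2_norm_cong_AE grad_add grad_in_L2 L2_add H1_add)
  then have "L2_norm \<Omega> (grad \<Omega> (u + v)) \<le> L2_norm \<Omega> (grad \<Omega> u) + L2_norm \<Omega> (grad \<Omega> v)"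
    using u v by (simp add: L2_norm_triangle grad_in_L2)
  then have "H1_norm \<Omega> (u + v) \<le> sqrt ((L2_norm \<Omega> u + L2_norm \<Omega> v)\<^sup>2
      + (L2_norm \<Omega> (grad \<Omega> u) + L2_norm \<Omega> (grad \<Omega> v))\<^sup>2)"
    unfolding H1_norm_def using u v
    by (intro real_sqrt_le_mono add_mono power_mono L2_norm_triangle H1_in_L2 L2_norm_nonneg)
  also have "\<dots> \<le> H1_norm \<Omega> u + H1_norm \<Omega> v"
    unfolding H1_norm_def by (rule real_sqrt_sum_squares_triangle_ineq)
  finally show ?thesis .
qed

lemma H1_norm_scaleR:
  assumes "u \<in> H1 \<Omega>"
  shows "H1_norm \<Omega> (c *\<^sub>R u) = \<bar>c\<bar> * H1_norm \<Omega> u"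
proof -
  have "L2_norm \<Omega> (grad \<Omega> (c *\<^sub>R u)) = L2_norm \<Omega> (c *\<^sub>R grad \<Omega> u)"
    using assms by (intro L2_norm_cong_AE grad_scaleR grad_in_L2 L2_scaleR H1_scaleR)
  then show ?thesis
    by (simp add: H1_norm_def L2_norm_scaleR power_mult_distrib distrib_left[symmetric] real_sqrt_mult)
qed

lemma H10_in_H1: "u \<in> H10 \<Omega> \<Longrightarrow> u \<in> H1 \<Omega>"
  by (simp add: H10_def)

lemma test_function_in_H10:
  assumes "\<phi> \<in> test_functions \<Omega>"
  shows "\<phi> \<in> H10 \<Omega>"
proof -
  have "H1_norm \<Omega> (\<phi> - \<phi>) = 0"
    using H1_norm_scaleR[OF test_function_in_H1[OF assms], of 0] by simp
  then show ?thesis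
    unfolding H10_def using assms test_function_in_H1[OF assms] by (auto intro!: exI[of _ "\<lambda>_. \<phi>"])
qed

lemma H10_zero: "0 \<in> H10 \<Omega>"
  by (rule test_function_in_H10[OF test_functions_zero])

lemma H10_add:
  assumes u: "u \<in> H10 \<Omega>" and v: "v \<in> H10 \<Omega>"
  shows "u + v \<in> H10 \<Omega>"
proof -
  obtain \<phi> \<psi> where \<phi>: "\<And>k. \<phi> k \<in> test_functions \<Omega>" "(\<lambda>k. H1_norm \<Omega> (u - \<phi> k)) \<longlonglongrightarrow> 0"
    and \<psi>: "\<And>k. \<psi> k \<in> test_functions \<Omega>" "(\<lambda>k. H1_norm \<Omega> (v - \<psi> k)) \<longlonglongrightarrow> 0"
    using u v by (auto simp: H10_def)
  have "(\<lambda>k. H1_norm \<Omega> (u + v - (\<phi> k + \<psi> k))) \<longlonglongrightarrow> 0"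
  proof (rule tendsto_sandwich[OF _ _ tendsto_const])
    show "(\<lambda>k. H1_norm \<Omega> (u - \<phi> k) + H1_norm \<Omega> (v - \<psi> k)) \<longlonglongrightarrow> 0"
      using tendsto_add[OF \<phi>(2) \<psi>(2)] by simp
    have "H1_norm \<Omega> (u + v - (\<phi> k + \<psi> k)) \<le> H1_norm \<Omega> (u - \<phi> k) + H1_norm \<Omega> (v - \<psi> k)" for k
      using H1_norm_triangle[OF H1_diff[OF H10_in_H1[OF u] test_function_in_H1[OF \<phi>(1)]]
          H1_diff[OF H10_in_H1[OF v] test_function_in_H1[OF \<psi>(1)]], of k k]
      by (simp only: add_diff_add)
    then show "\<forall>\<^sub>F k in sequentially.
        H1_norm \<Omega> (u + v - (\<phi> k + \<psi> k)) \<le> H1_norm \<Omega> (u - \<phi> k) + H1_norm \<Omega> (v - \<psi> k)" by simp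
  qed (simp add: H1_norm_nonneg)
  moreover have "\<forall>k. \<phi> k + \<psi> k \<in> test_functions \<Omega>" using \<phi>(1) \<psi>(1) test_functions_add by blast
  moreover have "u + v \<in> H1 \<Omega>" using u v H1_add H10_in_H1 by blast
  ultimately show ?thesis
    unfolding H10_def mem_Collect_eq
    by (intro conjI exI[of _ "\<lambda>k. \<phi> k + \<psi> k"])
qed

lemma H10_scaleR:
  assumes u: "u \<in> H10 \<Omega>"
  shows "c *\<^sub>R u \<in> H10 \<Omega>"
proof -
  obtain \<phi> where \<phi>: "\<And>k. \<phi> k \<in> test_functions \<Omega>" "(\<lambda>k. H1_norm \<Omega> (u - \<phi> k)) \<longlonglongrightarrow> 0"
    using u by (auto simp: H10_def)
  have "H1_norm \<Omega> (c *\<^sub>R u - c *\<^sub>R \<phi> k) = \<bar>c\<bar> * H1_norm \<Omega> (u - \<phi> k)" for k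
    using H1_norm_scaleR[OF H1_diff[OF H10_in_H1[OF u] test_function_in_H1[OF \<phi>(1)]], of c k]
    by (simp only: scaleR_diff_right)
  then have "(\<lambda>k. H1_norm \<Omega> (c *\<^sub>R u - c *\<^sub>R \<phi> k)) \<longlonglongrightarrow> 0"
    using tendsto_mult_right_zero[OF \<phi>(2), of "\<bar>c\<bar>"] by simp
  moreover have "\<forall>k. c *\<^sub>R \<phi> k \<in> test_functions \<Omega>" using \<phi>(1) test_functions_scaleR by blast
  moreover have "c *\<^sub>R u \<in> H1 \<Omega>" using u H1_scaleR H10_in_H1 by blast
  ultimately show ?thesis
    unfolding H10_def mem_Collect_eq
    by (intro conjI exI[of _ "\<lambda>k. c *\<^sub>R \<phi> k"])
qed

lemma H10_diff: "u \<in> H10 \<Omega> \<Longrightarrow> v \<in> H10 \<Omega> \<Longrightarrow> u - v \<in> H10 \<Omega>"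
  using H10_add[of u "(-1) *\<^sub>R v"] H10_scaleR[of v "-1"] by simp

end

section \<open>Bumps as divergences\<close>

text \<open>
  A bump is a product of functions of one coordinate, so it is enough to integrate one factor.  Thus
  every bump is the divergence of the smooth vector field with the single component \<open>\<phi>\<close>.
\<close>

lemma smooth_box_bump_antiderivative:
  fixes i :: "'n::finite" and a b :: "real ^ 'n"
  obtains \<phi> :: "real ^ 'n \<Rightarrow> real" where "smooth \<phi>" "partial i \<phi> = box_bump k a b"
proof -
  have "isCont (interval_bump k (a $ i) (b $ i)) t" for t
  proof -
    have "isCont (flat 0) s" for s using flat_has_derivative by (rule DERIV_isCont)
    then have "isCont (\<lambda>s. flat 0 (h s)) t" if "isCont h t" for h
      using isCont_o2[OF that] by blast
    then show ?thesis
      unfolding interval_bump_def by (simp add: continuous_intros)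
  qed
  then obtain F where F: "\<And>t. (F has_vector_derivative interval_bump k (a $ i) (b $ i) t) (at t)"
    using einterval_antiderivative[of "-\<infinity>" "\<infinity>" "interval_bump k (a $ i) (b $ i)"] by auto
  define \<Phi> where "\<Phi> = (\<lambda>x :: real ^ 'n. F (x $ i))"
  define P where "P = (\<lambda>x :: real ^ 'n. \<Prod>j\<in>UNIV - {i}. interval_bump k (a $ j) (b $ j) (x $ j))"
  have der: "(\<Phi> has_derivative (\<lambda>h. h $ i * interval_bump k (a $ i) (b $ i) (x $ i))) (at x)" for x
    unfolding \<Phi>_def
    using has_derivative_compose[OF bounded_linear.has_derivative[OF bounded_linear_vec_nth has_derivative_ident]
        F[unfolded has_vector_derivative_def], of i x] by simp
  have part: "partial j \<Phi> = (\<lambda>x. axis j 1 $ i) * (\<lambda>x. interval_bump k (a $ i) (b $ i) (x $ i))" for j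
    using partial_has_derivative[OF der] by (auto simp: fun_eq_iff)
  have smooth_\<Phi>: "smooth \<Phi>"
  proof (rule smooth_if_partials_smooth)
    show "\<Phi> differentiable at x" for x using der unfolding differentiable_def by blast
    show "smooth (partial j \<Phi>)" for j
      unfolding part by (intro smooth_mult smooth_const smooth_interval_bump)
  qed
  have smooth_P: "smooth P" unfolding P_def by (intro smooth_prod smooth_interval_bump) simp
  \<comment> \<open>\<open>P\<close> is constant along lines in direction \<open>i\<close>.\<close>
  have P0: "partial i P = 0"
  proof
    fix x
    have "P (x + t *\<^sub>R axis i 1) = P x" for t
      unfolding P_def by (intro prod.cong) (auto simp: axis_def)
    then have "((\<lambda>_. P x) has_real_derivative partial i P (x + 0 *\<^sub>R axis i 1)) (at 0)"
      using smooth_directional_derivative[OF smooth_P, of x i 0] by simp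
    from DERIV_unique[OF this DERIV_const] show "partial i P x = 0 x" by simp
  qed
  have "partial i (\<Phi> * P) = \<Phi> * partial i P + partial i \<Phi> * P"
    by (intro partial_mult smooth_differentiable smooth_\<Phi> smooth_P)
  also have "\<dots> = box_bump k a b"
    unfolding P0 part by (simp add: fun_eq_iff P_def box_bump_def prod.remove[of UNIV i])
  finally show ?thesis using that smooth_mult[OF smooth_\<Phi> smooth_P] by blast
qed

context bounded_open
begin

text \<open>
  Against a test function this is integration by parts.  Both sides are continuous in the norm of
  \<open>H\<^sup>1(\<Omega>)\<close>, and test functions are dense in \<open>H\<^sup>1\<^sub>0(\<Omega>)\<close>.
\<close>

lemma smooth_field_divergence:
  assumes \<phi>: "smooth \<phi>"
  shows "(\<lambda>x. \<phi> x *\<^sub>R axis i 1 :: real ^ 'n) \<in> L2 \<Omega>"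
    and "L2_represents \<Omega> (divergence \<Omega> (\<lambda>x. \<phi> x *\<^sub>R axis i 1) + 0) (partial i \<phi>)"
proof -
  let ?\<tau> = "\<lambda>x. \<phi> x *\<^sub>R axis i 1 :: real ^ 'n"
  show \<tau>: "?\<tau> \<in> L2 \<Omega>"
    using open_domain bounded_domain smooth_continuous_on[OF \<phi>]
    by (intro continuous_on_bounded_open_in_L2 continuous_intros)
  have z: "partial i \<phi> \<in> L2 \<Omega>" by (rule smooth_in_L2[OF smooth_partial[OF \<phi>]])
  define F where "F v = L2_inner \<Omega> ?\<tau> (grad \<Omega> v) + L2_inner \<Omega> (partial i \<phi>) v" for v
  have F_test: "F \<psi> = 0" if \<psi>: "\<psi> \<in> test_functions \<Omega>" for \<psi>
  proof -
    note g = weak_gradient_test_function[OF \<psi>]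
    have "L2_inner \<Omega> ?\<tau> (grad \<Omega> \<psi>) = L2_inner \<Omega> ?\<tau> (\<lambda>x. \<chi> i. partial i \<psi> x)"
      by (rule L2_inner_cong_AE[OF \<tau> \<tau> grad_in_L2[OF test_function_in_H1[OF \<psi>]] is_weak_gradientD(1)[OF g]
            _ grad_AE_eq[OF g]]) simp
    also have "\<dots> = L2_inner \<Omega> \<phi> (partial i \<psi>)"
      by (simp add: L2_inner_def inner_commute[of "axis i 1"] inner_axis)
    finally show ?thesis using integration_by_parts[OF \<phi> \<psi>, of i] by (simp add: F_def)
  qed
  have "F v = 0" if v: "v \<in> H10 \<Omega>" for v
  proof -
    obtain \<psi> where \<psi>: "\<And>k. \<psi> k \<in> test_functions \<Omega>" "(\<lambda>k. H1_norm \<Omega> (v - \<psi> k)) \<longlonglongrightarrow> 0"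
      using v by (auto simp: H10_def)
    have bound: "\<bar>F v\<bar> \<le> (L2_norm \<Omega> ?\<tau> + L2_norm \<Omega> (partial i \<phi>)) * H1_norm \<Omega> (v - \<psi> k)" for k
    proof -
      note v1 = H10_in_H1[OF v] and p1 = test_function_in_H1[OF \<psi>(1)[of k]]
      note d1 = H1_diff[OF v1 p1]
      have "L2_inner \<Omega> ?\<tau> (grad \<Omega> (v - \<psi> k)) = L2_inner \<Omega> ?\<tau> (grad \<Omega> v) - L2_inner \<Omega> ?\<tau> (grad \<Omega> (\<psi> k))"
        unfolding L2_inner_diff_right[OF grad_in_L2[OF v1] grad_in_L2[OF p1] \<tau>, symmetric]
        by (rule L2_inner_cong_AE[OF \<tau> \<tau> grad_in_L2[OF d1] L2_diff[OF grad_in_L2[OF v1] grad_in_L2[OF p1]]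
              _ grad_diff[OF v1 p1]]) simp
      then have "F v = L2_inner \<Omega> ?\<tau> (grad \<Omega> (v - \<psi> k)) + L2_inner \<Omega> (partial i \<phi>) (v - \<psi> k)"
        using F_test[OF \<psi>(1), of k]
        by (simp add: F_def L2_inner_diff_right z H1_in_L2[OF v1] H1_in_L2[OF p1])
      moreover have "\<bar>L2_inner \<Omega> ?\<tau> (grad \<Omega> (v - \<psi> k))\<bar> \<le> L2_norm \<Omega> ?\<tau> * H1_norm \<Omega> (v - \<psi> k)"
        using L2_Cauchy_Schwarz[OF \<tau> grad_in_L2[OF d1]]
          mult_left_mono[OF L2_norm_grad_le_H1_norm L2_norm_nonneg[of \<Omega> ?\<tau>], of "v - \<psi> k"] by linarith
      moreover have "\<bar>L2_inner \<Omega> (partial i \<phi>) (v - \<psi> k)\<bar> \<le> L2_norm \<Omega> (partial i \<phi>) * H1_norm \<Omega> (v - \<psi> k)"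
        using L2_Cauchy_Schwarz[OF z H1_in_L2[OF d1]]
          mult_left_mono[OF L2_norm_le_H1_norm L2_norm_nonneg[of \<Omega> "partial i \<phi>"], of "v - \<psi> k"] by linarith
      ultimately show ?thesis by (simp add: distrib_right)
    qed
    have "(\<lambda>k. (L2_norm \<Omega> ?\<tau> + L2_norm \<Omega> (partial i \<phi>)) * H1_norm \<Omega> (v - \<psi> k)) \<longlonglongrightarrow> 0"
      using tendsto_mult_right_zero[OF \<psi>(2)] by simp
    then have "\<bar>F v\<bar> \<le> 0" using bound by (intro LIMSEQ_le_const) auto
    then show ?thesis by simp
  qed
  then have "(divergence \<Omega> ?\<tau> + 0) v = L2_inner \<Omega> (partial i \<phi>) v" if "v \<in> H10 \<Omega>" for v
    using that by (fastforce simp: divergence_def F_def)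
  with z show "L2_represents \<Omega> (divergence \<Omega> ?\<tau> + 0) (partial i \<phi>)"
    unfolding L2_represents_def by blast
qed

section \<open>The space of triples and the bilinear form\<close>

lemma L2_represents_unique:
  assumes w: "L2_represents \<Omega> l w" and z: "L2_represents \<Omega> l z"
  shows "AE x in lebesgue_on \<Omega>. w x = z x"
proof -
  have L: "w \<in> L2 \<Omega>" "z \<in> L2 \<Omega>" using w z by (simp_all add: L2_represents_def)
  have "AE x in lebesgue_on \<Omega>. (w - z) x = 0"
  proof (rule AE_zero_if_orthogonal_to_test_functions)
    show "w - z \<in> L2 \<Omega>" using L by (rule L2_diff)
    show "L2_inner \<Omega> (w - z) \<phi> = 0" if \<phi>: "\<phi> \<in> test_functions \<Omega>" for \<phi>
    proof -
      have "L2_inner \<Omega> w \<phi> = l \<phi>" "L2_inner \<Omega> z \<phi> = l \<phi>"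
        using w z test_function_in_H10[OF \<phi>] by (simp_all add: L2_represents_def)
      then show ?thesis by (simp add: L2_inner_diff_left L test_function_in_L2[OF \<phi>])
    qed
  qed
  then show ?thesis by eventually_elim simp
qed

lemma div_plus_represents:
  assumes "L2_represents \<Omega> (divergence \<Omega> \<sigma> + l) w"
  shows "L2_represents \<Omega> (divergence \<Omega> \<sigma> + l) (div_plus \<Omega> \<sigma> l)"
  unfolding div_plus_def
  by (rule someI[of "L2_represents \<Omega> (divergence \<Omega> \<sigma> + l)" w, OF assms])

lemma div_plus_AE_eq:
  "L2_represents \<Omega> (divergence \<Omega> \<sigma> + l) w \<Longrightarrow> AE x in lebesgue_on \<Omega>. div_plus \<Omega> \<sigma> l x = w x"
  using L2_represents_unique div_plus_represents by blast

lemma L2_represents_add: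
  assumes w: "L2_represents \<Omega> (divergence \<Omega> \<sigma> + l) w" and z: "L2_represents \<Omega> (divergence \<Omega> \<tau> + m) z"
    and \<sigma>: "\<sigma> \<in> L2 \<Omega>" and \<tau>: "\<tau> \<in> L2 \<Omega>"
  shows "L2_represents \<Omega> (divergence \<Omega> (\<sigma> + \<tau>) + (l + m)) (w + z)"
  unfolding L2_represents_def
proof (intro conjI ballI)
  have L: "w \<in> L2 \<Omega>" "z \<in> L2 \<Omega>" using w z by (simp_all add: L2_represents_def)
  then show "w + z \<in> L2 \<Omega>" by (rule L2_add)
  fix v assume v: "v \<in> H10 \<Omega>"
  have "L2_inner \<Omega> w v = (divergence \<Omega> \<sigma> + l) v" "L2_inner \<Omega> z v = (divergence \<Omega> \<tau> + m) v"
    using w z v by (simp_all add: L2_represents_def)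
  then show "(divergence \<Omega> (\<sigma> + \<tau>) + (l + m)) v = L2_inner \<Omega> (w + z) v"
    by (simp add: divergence_def L2_inner_add_left L \<sigma> \<tau> H1_in_L2 grad_in_L2 H10_in_H1[OF v])
qed

lemma L2_represents_diff:
  assumes w: "L2_represents \<Omega> (divergence \<Omega> \<sigma> + l) w" and z: "L2_represents \<Omega> (divergence \<Omega> \<tau> + m) z"
    and \<sigma>: "\<sigma> \<in> L2 \<Omega>" and \<tau>: "\<tau> \<in> L2 \<Omega>"
  shows "L2_represents \<Omega> (divergence \<Omega> (\<sigma> - \<tau>) + (l - m)) (w - z)"
  unfolding L2_represents_def
proof (intro conjI ballI)
  have L: "w \<in> L2 \<Omega>" "z \<in> L2 \<Omega>" using w z by (simp_all add: L2_represents_def)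
  then show "w - z \<in> L2 \<Omega>" by (rule L2_diff)
  fix v assume v: "v \<in> H10 \<Omega>"
  have "L2_inner \<Omega> w v = (divergence \<Omega> \<sigma> + l) v" "L2_inner \<Omega> z v = (divergence \<Omega> \<tau> + m) v"
    using w z v by (simp_all add: L2_represents_def)
  then show "(divergence \<Omega> (\<sigma> - \<tau>) + (l - m)) v = L2_inner \<Omega> (w - z) v"
    by (simp add: divergence_def L2_inner_diff_left L \<sigma> \<tau> H1_in_L2 grad_in_L2 H10_in_H1[OF v])
qed

lemma U_spaceD:
  assumes "(u, \<sigma>, l) \<in> U_space \<Omega>"
  shows "u \<in> H10 \<Omega>" "u \<in> H1 \<Omega>" "u \<in> L2 \<Omega>" "grad \<Omega> u \<in> L2 \<Omega>" "\<sigma> \<in> L2 \<Omega>" "l \<in> Hm1 \<Omega>"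
    "L2_represents \<Omega> (divergence \<Omega> \<sigma> + l) (div_plus \<Omega> \<sigma> l)" "div_plus \<Omega> \<sigma> l \<in> L2 \<Omega>"
proof -
  show u: "u \<in> H10 \<Omega>" and "\<sigma> \<in> L2 \<Omega>" "l \<in> Hm1 \<Omega>" using assms by (auto simp: U_space_def)
  show H1: "u \<in> H1 \<Omega>" using u by (rule H10_in_H1)
  show "u \<in> L2 \<Omega>" "grad \<Omega> u \<in> L2 \<Omega>" using H1 by (rule H1_in_L2, rule grad_in_L2)
  show rep: "L2_represents \<Omega> (divergence \<Omega> \<sigma> + l) (div_plus \<Omega> \<sigma> l)"
    using assms div_plus_represents by (auto simp: U_space_def)
  then show "div_plus \<Omega> \<sigma> l \<in> L2 \<Omega>" by (simp add: L2_represents_def)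
qed

lemma functional_eq_inner:
  assumes "(v, \<tau>, m) \<in> U_space \<Omega>" "u \<in> H10 \<Omega>"
  shows "m u = L2_inner \<Omega> (div_plus \<Omega> \<tau> m) u + L2_inner \<Omega> \<tau> (grad \<Omega> u)"
  using bspec[OF conjunct2[OF U_spaceD(7)[OF assms(1), unfolded L2_represents_def]] assms(2)]
  by (simp add: divergence_def)

lemma Hm1_diff:
  assumes l: "l \<in> Hm1 \<Omega>" and m: "m \<in> Hm1 \<Omega>"
  shows "l - m \<in> Hm1 \<Omega>"
proof -
  obtain C D where C: "\<And>v. v \<in> H10 \<Omega> \<Longrightarrow> \<bar>l v\<bar> \<le> C * H1_norm \<Omega> v"
    and D: "\<And>v. v \<in> H10 \<Omega> \<Longrightarrow> \<bar>m v\<bar> \<le> D * H1_norm \<Omega> v"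
    using l m unfolding Hm1_def by blast
  have "\<forall>v\<in>H10 \<Omega>. \<bar>(l - m) v\<bar> \<le> (C + D) * H1_norm \<Omega> v"
  proof
    fix v assume "v \<in> H10 \<Omega>"
    then show "\<bar>(l - m) v\<bar> \<le> (C + D) * H1_norm \<Omega> v"
      using C[of v] D[of v] by (simp add: distrib_right)
  qed
  then have "\<exists>C. \<forall>v\<in>H10 \<Omega>. \<bar>(l - m) v\<bar> \<le> C * H1_norm \<Omega> v" ..
  with l m show ?thesis by (simp add: Hm1_def right_diff_distrib)
qed

lemma Hm1_apply_diff:
  assumes m: "m \<in> Hm1 \<Omega>" and u: "u \<in> H10 \<Omega>" and v: "v \<in> H10 \<Omega>"
  shows "m (u - v) = m u - m v"
proof -
  have "m (u - v + v) = m (u - v) + m v"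
    using m H10_diff[OF u v] v unfolding Hm1_def by blast
  then show ?thesis by simp
qed

lemma U_space_diff:
  assumes x: "(u, \<sigma>, l) \<in> U_space \<Omega>" and y: "(v, \<tau>, m) \<in> U_space \<Omega>"
  shows "(u - v, \<sigma> - \<tau>, l - m) \<in> U_space \<Omega>"
    and "AE x in lebesgue_on \<Omega>. div_plus \<Omega> (\<sigma> - \<tau>) (l - m) x = (div_plus \<Omega> \<sigma> l - div_plus \<Omega> \<tau> m) x"
proof -
  have rep: "L2_represents \<Omega> (divergence \<Omega> (\<sigma> - \<tau>) + (l - m)) (div_plus \<Omega> \<sigma> l - div_plus \<Omega> \<tau> m)"
    by (rule L2_represents_diff[OF U_spaceD(7)[OF x] U_spaceD(7)[OF y] U_spaceD(5)[OF x] U_spaceD(5)[OF y]])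
  then show "AE x in lebesgue_on \<Omega>. div_plus \<Omega> (\<sigma> - \<tau>) (l - m) x = (div_plus \<Omega> \<sigma> l - div_plus \<Omega> \<tau> m) x"
    by (rule div_plus_AE_eq)
  show "(u - v, \<sigma> - \<tau>, l - m) \<in> U_space \<Omega>"
    using H10_diff[OF U_spaceD(1)[OF x] U_spaceD(1)[OF y]] L2_diff[OF U_spaceD(5)[OF x] U_spaceD(5)[OF y]]
      Hm1_diff[OF U_spaceD(6)[OF x] U_spaceD(6)[OF y]] rep
    unfolding U_space_def by blast
qed

lemma c_form_diff_left:
  assumes x: "(u, \<sigma>, l) \<in> U_space \<Omega>" and y: "(v, \<tau>, m) \<in> U_space \<Omega>" and z: "(q, \<rho>, n) \<in> U_space \<Omega>"
  shows "c_form \<Omega> \<beta> ((u, \<sigma>, l) - (v, \<tau>, m)) (q, \<rho>, n)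
    = c_form \<Omega> \<beta> (u, \<sigma>, l) (q, \<rho>, n) - c_form \<Omega> \<beta> (v, \<tau>, m) (q, \<rho>, n)"
proof -
  note X = U_spaceD[OF x] and Y = U_spaceD[OF y] and Z = U_spaceD[OF z]
    and XY = U_spaceD[OF U_space_diff(1)[OF x y]]
  have d: "L2_inner \<Omega> (div_plus \<Omega> (\<sigma> - \<tau>) (l - m)) (div_plus \<Omega> \<rho> n)
      = L2_inner \<Omega> (div_plus \<Omega> \<sigma> l) (div_plus \<Omega> \<rho> n) - L2_inner \<Omega> (div_plus \<Omega> \<tau> m) (div_plus \<Omega> \<rho> n)"
    unfolding L2_inner_diff_left[OF X(8) Y(8) Z(8), symmetric]
    by (rule L2_inner_cong_AE[OF XY(8) L2_diff[OF X(8) Y(8)] Z(8) Z(8) U_space_diff(2)[OF x y]]) simp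
  have "L2_inner \<Omega> (grad \<Omega> (u - v) - (\<sigma> - \<tau>)) (grad \<Omega> q - \<rho>)
      = L2_inner \<Omega> (grad \<Omega> u - grad \<Omega> v - (\<sigma> - \<tau>)) (grad \<Omega> q - \<rho>)"
  proof (rule L2_inner_cong_AE)
    show "AE x in lebesgue_on \<Omega>. (grad \<Omega> (u - v) - (\<sigma> - \<tau>)) x = (grad \<Omega> u - grad \<Omega> v - (\<sigma> - \<tau>)) x"
      using grad_diff[OF X(2) Y(2)] by eventually_elim simp
  qed (use XY X Y Z in \<open>auto intro!: L2_diff\<close>)
  also have "\<dots> = L2_inner \<Omega> (grad \<Omega> u - \<sigma>) (grad \<Omega> q - \<rho>) - L2_inner \<Omega> (grad \<Omega> v - \<tau>) (grad \<Omega> q - \<rho>)"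
    using X Y Z by (simp add: L2_inner_diff_left L2_inner_diff_right L2_diff)
  finally show ?thesis
    using d Hm1_apply_diff[OF Z(6) X(1) Y(1)] by (simp add: right_diff_distrib)
qed

lemma c_form_diff_right:
  assumes x: "(u, \<sigma>, l) \<in> U_space \<Omega>" and y: "(v, \<tau>, m) \<in> U_space \<Omega>" and z: "(q, \<rho>, n) \<in> U_space \<Omega>"
  shows "c_form \<Omega> \<beta> (q, \<rho>, n) ((u, \<sigma>, l) - (v, \<tau>, m))
    = c_form \<Omega> \<beta> (q, \<rho>, n) (u, \<sigma>, l) - c_form \<Omega> \<beta> (q, \<rho>, n) (v, \<tau>, m)"
proof -
  note X = U_spaceD[OF x] and Y = U_spaceD[OF y] and Z = U_spaceD[OF z]
    and XY = U_spaceD[OF U_space_diff(1)[OF x y]]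
  have d: "L2_inner \<Omega> (div_plus \<Omega> \<rho> n) (div_plus \<Omega> (\<sigma> - \<tau>) (l - m))
      = L2_inner \<Omega> (div_plus \<Omega> \<rho> n) (div_plus \<Omega> \<sigma> l) - L2_inner \<Omega> (div_plus \<Omega> \<rho> n) (div_plus \<Omega> \<tau> m)"
    unfolding L2_inner_diff_right[OF X(8) Y(8) Z(8), symmetric]
    by (rule L2_inner_cong_AE[OF Z(8) Z(8) XY(8) L2_diff[OF X(8) Y(8)] _ U_space_diff(2)[OF x y]]) simp
  have "L2_inner \<Omega> (grad \<Omega> q - \<rho>) (grad \<Omega> (u - v) - (\<sigma> - \<tau>))
      = L2_inner \<Omega> (grad \<Omega> q - \<rho>) (grad \<Omega> u - grad \<Omega> v - (\<sigma> - \<tau>))"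
  proof (rule L2_inner_cong_AE)
    show "AE x in lebesgue_on \<Omega>. (grad \<Omega> (u - v) - (\<sigma> - \<tau>)) x = (grad \<Omega> u - grad \<Omega> v - (\<sigma> - \<tau>)) x"
      using grad_diff[OF X(2) Y(2)] by eventually_elim simp
  qed (use XY X Y Z in \<open>auto intro!: L2_diff\<close>)
  also have "\<dots> = L2_inner \<Omega> (grad \<Omega> q - \<rho>) (grad \<Omega> u - \<sigma>) - L2_inner \<Omega> (grad \<Omega> q - \<rho>) (grad \<Omega> v - \<tau>)"
    using X Y Z by (simp add: L2_inner_diff_left L2_inner_diff_right L2_diff)
  finally show ?thesis
    using d by (simp add: right_diff_distrib)
qed

lemma U_norm_power2:
  "(U_norm \<Omega> (u, \<sigma>, l))\<^sup>2
    = (L2_norm \<Omega> (grad \<Omega> u))\<^sup>2 + (L2_norm \<Omega> \<sigma>)\<^sup>2 + (L2_norm \<Omega> (div_plus \<Omega> \<sigma> l))\<^sup>2"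
  by simp

lemma L2_norm_le_U_norm:
  "L2_norm \<Omega> (grad \<Omega> u) \<le> U_norm \<Omega> (u, \<sigma>, l)" "L2_norm \<Omega> \<sigma> \<le> U_norm \<Omega> (u, \<sigma>, l)"
  "L2_norm \<Omega> (div_plus \<Omega> \<sigma> l) \<le> U_norm \<Omega> (u, \<sigma>, l)"
  by (auto intro!: real_le_rsqrt)

lemma friedrichs_inequality:
  "friedrichs_constant \<Omega> C \<Longrightarrow> v \<in> H10 \<Omega> \<Longrightarrow> L2_norm \<Omega> v \<le> C * L2_norm \<Omega> (grad \<Omega> v)"
  by (simp add: friedrichs_constant_def)

text \<open>
  On the diagonal \<open>\<langle>\<lambda>, u\<rangle> = (div \<sigma> + \<lambda>, u) + (\<sigma>, \<nabla>u)\<close>, which cancels half of the mixed term of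
  \<open>\<parallel>\<nabla>u - \<sigma>\<parallel>\<^sup>2\<close> and leaves
  \<open>\<beta> \<parallel>div \<sigma> + \<lambda>\<parallel>\<^sup>2 + \<parallel>\<nabla>u\<parallel>\<^sup>2 - (\<nabla>u, \<sigma>) + \<parallel>\<sigma>\<parallel>\<^sup>2 + (div \<sigma> + \<lambda>, u)\<close>.
  By the inequalities of Friedrichs and Young the last term is at least \<open>- C\<^sup>2 \<parallel>div \<sigma> + \<lambda>\<parallel>\<^sup>2 - \<parallel>\<nabla>u\<parallel>\<^sup>2 / 4\<close>; the part \<open>C\<^sup>2\<close>
  of \<open>\<beta>\<close> absorbs the first of these two terms.
\<close>

lemma c_form_coercive:
  assumes C: "friedrichs_constant \<Omega> C" and \<beta>: "\<beta> \<ge> 1 + C\<^sup>2" and x: "(u, \<sigma>, l) \<in> U_space \<Omega>"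
  shows "(U_norm \<Omega> (u, \<sigma>, l))\<^sup>2 / 4 \<le> c_form \<Omega> \<beta> (u, \<sigma>, l) (u, \<sigma>, l)"
proof -
  note X = U_spaceD[OF x]
  define a s w where "a = L2_norm \<Omega> (grad \<Omega> u)" and "s = L2_norm \<Omega> \<sigma>" and "w = L2_norm \<Omega> (div_plus \<Omega> \<sigma> l)"
  have nn: "0 \<le> a" "0 \<le> s" "0 \<le> w" by (simp_all add: a_def s_def w_def L2_norm_nonneg)
  define p where "p = L2_inner \<Omega> (grad \<Omega> u) \<sigma>"
  define q where "q = L2_inner \<Omega> (div_plus \<Omega> \<sigma> l) u"
  have c: "c_form \<Omega> \<beta> (u, \<sigma>, l) (u, \<sigma>, l) = \<beta> * w\<^sup>2 + a\<^sup>2 - p + s\<^sup>2 + q"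
    using functional_eq_inner[OF x X(1)] X
    by (simp add: L2_inner_diff_left L2_inner_diff_right L2_diff L2_norm_power2 a_def s_def w_def p_def q_def
        L2_inner_commute[of \<Omega> \<sigma> "grad \<Omega> u"])
  have p: "p \<le> a * s" using L2_Cauchy_Schwarz[OF X(4,5)] by (simp add: p_def a_def s_def)
  have "\<bar>q\<bar> \<le> w * L2_norm \<Omega> u" using L2_Cauchy_Schwarz[OF X(8,3)] by (simp add: q_def w_def)
  also have "\<dots> \<le> w * (C * a)"
    using friedrichs_inequality[OF C X(1)] nn by (intro mult_left_mono) (auto simp: a_def)
  finally have q: "- q \<le> C * w * a" by (simp add: mult_ac)
  have "(1 + C\<^sup>2) * w\<^sup>2 \<le> \<beta> * w\<^sup>2" using \<beta> by (intro mult_right_mono) auto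
  then have "w\<^sup>2 + C\<^sup>2 * w\<^sup>2 \<le> \<beta> * w\<^sup>2" by (simp add: distrib_right)
  moreover have "0 \<le> (C * w - a / 2)\<^sup>2" by simp
  then have "C * w * a \<le> C\<^sup>2 * w\<^sup>2 + a\<^sup>2 / 4"
    by (simp add: power2_diff power_mult_distrib power_divide)
  moreover have "0 \<le> (a - s)\<^sup>2" by simp
  then have "2 * (a * s) \<le> a\<^sup>2 + s\<^sup>2" by (simp add: power2_diff)
  moreover have "0 \<le> w\<^sup>2" "0 \<le> s\<^sup>2" by simp_all
  ultimately have "(a\<^sup>2 + s\<^sup>2 + w\<^sup>2) / 4 \<le> \<beta> * w\<^sup>2 + a\<^sup>2 - p + s\<^sup>2 + q"
    using p q by argo
  then show ?thesis unfolding c U_norm_power2 by (simp add: a_def s_def w_def)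
qed

text \<open>
  The bound \<open>C \<le> 1 + C\<^sup>2 \<le> \<beta>\<close> keeps the constant independent of the Friedrichs constant.
\<close>

lemma c_form_bounded:
  assumes C: "friedrichs_constant \<Omega> C" and \<beta>: "\<beta> \<ge> 1 + C\<^sup>2"
    and x: "(u, \<sigma>, l) \<in> U_space \<Omega>" and y: "(v, \<tau>, m) \<in> U_space \<Omega>"
  shows "\<bar>c_form \<Omega> \<beta> (u, \<sigma>, l) (v, \<tau>, m)\<bar> \<le> (2 * \<beta> + 5) * (U_norm \<Omega> (u, \<sigma>, l) * U_norm \<Omega> (v, \<tau>, m))"
proof -
  note X = U_spaceD[OF x] and Y = U_spaceD[OF y]
  define N M where "N = U_norm \<Omega> (u, \<sigma>, l)" and "M = U_norm \<Omega> (v, \<tau>, m)"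
  have N: "L2_norm \<Omega> (grad \<Omega> u) \<le> N" "L2_norm \<Omega> \<sigma> \<le> N" "L2_norm \<Omega> (div_plus \<Omega> \<sigma> l) \<le> N"
    and M: "L2_norm \<Omega> (grad \<Omega> v) \<le> M" "L2_norm \<Omega> \<tau> \<le> M" "L2_norm \<Omega> (div_plus \<Omega> \<tau> m) \<le> M"
    unfolding N_def M_def by (rule L2_norm_le_U_norm)+
  have nn: "0 \<le> N" "0 \<le> M" using N(1) M(1) L2_norm_nonneg order_trans by blast+
  have C0: "0 < C" using C by (simp add: friedrichs_constant_def)
  \<comment> \<open>Expanding the square gives \<open>C \<le> C\<^sup>2 + 1 / 4\<close>.\<close>
  have "0 \<le> (C - 1 / 2)\<^sup>2" by simp
  then have "C \<le> C\<^sup>2 + 1 / 4" by (simp add: power2_diff power_divide)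
  then have C\<beta>: "C \<le> \<beta>" using \<beta> by linarith
  have "\<bar>L2_inner \<Omega> (div_plus \<Omega> \<sigma> l) (div_plus \<Omega> \<tau> m)\<bar> \<le> N * M"
    using L2_Cauchy_Schwarz[OF X(8) Y(8)] mult_mono[OF N(3) M(3) nn(1) L2_norm_nonneg] by linarith
  then have 1: "\<bar>\<beta> * L2_inner \<Omega> (div_plus \<Omega> \<sigma> l) (div_plus \<Omega> \<tau> m)\<bar> \<le> \<beta> * (N * M)"
    using C0 C\<beta> by (simp add: abs_mult)
  have "L2_norm \<Omega> (grad \<Omega> u - \<sigma>) \<le> 2 * N" "L2_norm \<Omega> (grad \<Omega> v - \<tau>) \<le> 2 * M"
    using L2_norm_diff_triangle[OF X(4,5)] L2_norm_diff_triangle[OF Y(4,5)] N M by linarith+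
  then have "L2_norm \<Omega> (grad \<Omega> u - \<sigma>) * L2_norm \<Omega> (grad \<Omega> v - \<tau>) \<le> (2 * N) * (2 * M)"
    using nn by (intro mult_mono) (auto simp: L2_norm_nonneg)
  then have 2: "\<bar>L2_inner \<Omega> (grad \<Omega> u - \<sigma>) (grad \<Omega> v - \<tau>)\<bar> \<le> 4 * (N * M)"
    using L2_Cauchy_Schwarz[OF L2_diff[OF X(4,5)] L2_diff[OF Y(4,5)]] by linarith
  have "L2_norm \<Omega> u \<le> C * N"
    using friedrichs_inequality[OF C X(1)] mult_left_mono[OF N(1), of C] C0 by linarith
  then have "L2_norm \<Omega> (div_plus \<Omega> \<tau> m) * L2_norm \<Omega> u \<le> M * (C * N)"
    using M(3) nn by (intro mult_mono) (auto simp: L2_norm_nonneg)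
  then have 3: "\<bar>L2_inner \<Omega> (div_plus \<Omega> \<tau> m) u\<bar> \<le> C * (N * M)"
    using L2_Cauchy_Schwarz[OF Y(8) X(3)] by (simp add: mult_ac)
  have 4: "\<bar>L2_inner \<Omega> \<tau> (grad \<Omega> u)\<bar> \<le> N * M"
    using L2_Cauchy_Schwarz[OF Y(5) X(4)] mult_mono[OF M(2) N(1) nn(2) L2_norm_nonneg]
    by (simp add: mult.commute)
  have 5: "C * (N * M) \<le> \<beta> * (N * M)" using C\<beta> nn by (intro mult_right_mono) auto
  have "\<bar>c_form \<Omega> \<beta> (u, \<sigma>, l) (v, \<tau>, m)\<bar> \<le> (2 * \<beta> + 5) * (N * M)"
    using 1 2 3 4 5 functional_eq_inner[OF y X(1)] by (simp add: distrib_right)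
  then show ?thesis by (simp add: N_def M_def)
qed

section \<open>The error estimate\<close>

text \<open>
  Adding \<open>(v, \<tau>, 0)\<close> with \<open>div \<tau> \<in> L\<^sup>2(\<Omega>)\<close> to the solution does not leave \<open>K\<^sup>1\<close>, as the constraint concerns
  \<open>\<lambda>\<close> alone.  With \<open>q = \<nabla>u - \<sigma>\<close> the variational inequality gives
  \<open>\<beta> (div \<sigma> + \<lambda> + f, div \<tau>) + (q, \<nabla>v - \<tau>) \<ge> 0\<close>.
  The choice \<open>\<tau> = 0\<close> shows \<open>div q = 0\<close>.  Hence \<open>\<tau> = q\<close> is admissible, and it shows \<open>q = 0\<close>.  It remains that
  \<open>div \<sigma> + \<lambda> + f\<close> is orthogonal to \<open>div \<tau>\<close> for all \<open>\<tau>\<close>.  Every bump is the divergence of some \<open>\<tau>\<close>,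
  and the fundamental lemma applies.
\<close>

lemma VI_solution_first_order:
  assumes \<beta>: "\<beta> > 0" and f: "f \<in> L2 \<Omega>" and sol: "VI_solution \<Omega> \<beta> f g (K1 \<Omega>) (u, \<sigma>, l)"
  shows "AE x in lebesgue_on \<Omega>. \<sigma> x = grad \<Omega> u x"
    and "AE x in lebesgue_on \<Omega>. div_plus \<Omega> \<sigma> l x = - f x"
proof -
  have U: "(u, \<sigma>, l) \<in> U_space \<Omega>" and l0: "nonneg_functional \<Omega> l"
    using sol by (auto simp: VI_solution_def K1_def)
  note X = U_spaceD[OF U]
  let ?w = "div_plus \<Omega> \<sigma> l" and ?q = "grad \<Omega> u - \<sigma>"
  have q: "?q \<in> L2 \<Omega>" using X(4,5) by (rule L2_diff)
  have wf: "?w + f \<in> L2 \<Omega>" using X(8) f by (rule L2_add)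
  have test: "0 \<le> \<beta> * L2_inner \<Omega> (?w + f) z + L2_inner \<Omega> ?q (grad \<Omega> v - \<tau>)"
    if v: "v \<in> H10 \<Omega>" and \<tau>: "\<tau> \<in> L2 \<Omega>" and z: "L2_represents \<Omega> (divergence \<Omega> \<tau> + 0) z" for v \<tau> z
  proof -
    have zL: "z \<in> L2 \<Omega>" using z by (simp add: L2_represents_def)
    have dL: "div_plus \<Omega> \<tau> 0 \<in> L2 \<Omega>" using div_plus_represents[OF z] by (simp add: L2_represents_def)
    have "L2_represents \<Omega> (divergence \<Omega> (\<sigma> + \<tau>) + l) (?w + z)"
      using L2_represents_add[OF X(7) z X(5) \<tau>] by simp
    then have "(u + v, \<sigma> + \<tau>, l) \<in> K1 \<Omega>"
      using H10_add[OF X(1) v] L2_add[OF X(5) \<tau>] X(6) l0 unfolding K1_def U_space_def by blast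
    then have "H_form \<Omega> \<beta> f g ((u + v, \<sigma> + \<tau>, l) - (u, \<sigma>, l)) \<le> c_form \<Omega> \<beta> (u, \<sigma>, l) ((u + v, \<sigma> + \<tau>, l) - (u, \<sigma>, l))"
      using sol unfolding VI_solution_def by blast
    then have "- \<beta> * L2_inner \<Omega> f (div_plus \<Omega> \<tau> 0)
        \<le> \<beta> * L2_inner \<Omega> ?w (div_plus \<Omega> \<tau> 0) + L2_inner \<Omega> ?q (grad \<Omega> v - \<tau>)"
      by simp
    moreover have "L2_inner \<Omega> f (div_plus \<Omega> \<tau> 0) = L2_inner \<Omega> f z"
      "L2_inner \<Omega> ?w (div_plus \<Omega> \<tau> 0) = L2_inner \<Omega> ?w z"
      using div_plus_AE_eq[OF z] by (auto intro!: L2_inner_cong_AE f X(8) dL zL)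
    ultimately show ?thesis
      by (simp add: L2_inner_add_left f X(8) zL distrib_left)
  qed
  have rep0: "L2_represents \<Omega> (divergence \<Omega> 0 + 0) 0"
    by (simp add: L2_represents_def L2_zero divergence_def)
  have orth: "L2_inner \<Omega> ?q (grad \<Omega> v) = 0" if v: "v \<in> H10 \<Omega>" for v
  proof (rule antisym)
    show "0 \<le> L2_inner \<Omega> ?q (grad \<Omega> v)" using test[OF v L2_zero rep0] by simp
    have "0 \<le> L2_inner \<Omega> ?q (grad \<Omega> ((-1) *\<^sub>R v))" using test[OF H10_scaleR[OF v, of "-1"] L2_zero rep0] by simp
    also have "\<dots> = L2_inner \<Omega> ?q ((-1) *\<^sub>R grad \<Omega> v)"
      by (rule L2_inner_cong_AE[OF q q grad_in_L2[OF H1_scaleR[OF H10_in_H1[OF v]]]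
            L2_scaleR[OF grad_in_L2[OF H10_in_H1[OF v]]] _ grad_scaleR[OF H10_in_H1[OF v]]]) simp
    also have "\<dots> = - L2_inner \<Omega> ?q (grad \<Omega> v)" by (simp only: L2_inner_scaleR_right)
    finally show "L2_inner \<Omega> ?q (grad \<Omega> v) \<le> 0" by simp
  qed
  have "L2_represents \<Omega> (divergence \<Omega> ?q + 0) 0"
    using orth by (simp add: L2_represents_def L2_zero divergence_def)
  from test[OF H10_zero q this] have "0 \<le> L2_inner \<Omega> ?q (grad \<Omega> 0 - ?q)" by simp
  also have "\<dots> = - L2_inner \<Omega> ?q ?q"
    using orth[OF H10_zero] grad_in_L2[OF H10_in_H1[OF H10_zero]] q by (simp add: L2_inner_diff_right)
  finally have "L2_inner \<Omega> ?q ?q = 0" using L2_inner_self_nonneg[of \<Omega> ?q] by linarith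
  then have q0: "AE x in lebesgue_on \<Omega>. ?q x = 0" using q by (intro L2_inner_self_eq_0_AE)
  then show "AE x in lebesgue_on \<Omega>. \<sigma> x = grad \<Omega> u x" by eventually_elim simp
  have "L2_inner \<Omega> (?w + f) (box_bump k a b) = 0" for k a b
  proof -
    \<comment> \<open>Any coordinate direction serves for the field that has the bump as its divergence.\<close>
    fix i :: 'n
    have ge: "0 \<le> L2_inner \<Omega> (?w + f) (partial i \<phi>)" if \<phi>: "smooth \<phi>" for \<phi>
    proof -
      note D = smooth_field_divergence[OF \<phi>, of i]
      have "L2_inner \<Omega> ?q (grad \<Omega> 0 - (\<lambda>x. \<phi> x *\<^sub>R axis i 1)) = L2_inner \<Omega> 0 (grad \<Omega> 0 - (\<lambda>x. \<phi> x *\<^sub>R axis i 1))"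
        using q0 D(1) X(4,5) grad_in_L2[OF H10_in_H1[OF H10_zero]]
        by (intro L2_inner_cong_AE L2_diff L2_zero) auto
      with test[OF H10_zero D] \<beta> show ?thesis by (simp add: zero_le_mult_iff)
    qed
    obtain \<phi> where \<phi>: "smooth \<phi>" "partial i \<phi> = box_bump k a b"
      by (rule smooth_box_bump_antiderivative)
    have "partial i ((\<lambda>x. - 1) * \<phi>) = (\<lambda>x. - 1) * partial i \<phi> + partial i (\<lambda>x. - 1) * \<phi>"
      by (intro partial_mult smooth_differentiable smooth_const \<phi>)
    also have "partial i (\<lambda>x. - 1) = 0" by (auto simp: fun_eq_iff intro: partial_has_derivative)
    also have "(\<lambda>x. - 1) * partial i \<phi> + 0 * \<phi> = - box_bump k a b"
      unfolding \<phi>(2) by (simp add: fun_eq_iff)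
    finally have neg: "partial i ((\<lambda>x. - 1) * \<phi>) = - box_bump k a b" .
    then show ?thesis
      using ge[OF \<phi>(1)] ge[OF smooth_mult[OF smooth_const[of "- 1"] \<phi>(1)]]
      unfolding \<phi>(2) neg L2_inner_uminus_right by linarith
  qed
  then have "AE x in lebesgue_on \<Omega>. (?w + f) x = 0"
    by (rule AE_zero_if_orthogonal_to_box_bumps[OF open_domain bounded_domain wf])
  then show "AE x in lebesgue_on \<Omega>. ?w x = - f x" by eventually_elim (simp add: eq_neg_iff_add_eq_0)
qed

text \<open>
  The least-squares terms of \<open>c\<^sub>\<beta>\<close> and \<open>H\<^sub>\<beta>\<close> cancel at the exact solution, so that the
  inequality is one for the multiplier alone.
\<close>

lemma VI_solution_residual:
  assumes f: "f \<in> L2 \<Omega>" and g: "g \<in> H10 \<Omega>" and U: "(u, \<sigma>, l) \<in> U_space \<Omega>"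
    and \<sigma>: "AE x in lebesgue_on \<Omega>. \<sigma> x = grad \<Omega> u x"
    and w: "AE x in lebesgue_on \<Omega>. div_plus \<Omega> \<sigma> l x = - f x"
    and y: "(v, \<tau>, m) \<in> U_space \<Omega>"
  shows "c_form \<Omega> \<beta> (u, \<sigma>, l) (v, \<tau>, m) - H_form \<Omega> \<beta> f g (v, \<tau>, m) = m (u - g)"
proof -
  note X = U_spaceD[OF U] and Y = U_spaceD[OF y]
  have "L2_inner \<Omega> (grad \<Omega> u - \<sigma>) (grad \<Omega> v - \<tau>) = L2_inner \<Omega> 0 (grad \<Omega> v - \<tau>)"
    using \<sigma> X Y by (intro L2_inner_cong_AE L2_diff L2_zero) auto
  moreover have "L2_inner \<Omega> (div_plus \<Omega> \<sigma> l) (div_plus \<Omega> \<tau> m) = L2_inner \<Omega> ((-1) *\<^sub>R f) (div_plus \<Omega> \<tau> m)"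
    using w X Y f by (intro L2_inner_cong_AE L2_scaleR) auto
  then have "L2_inner \<Omega> (div_plus \<Omega> \<sigma> l) (div_plus \<Omega> \<tau> m) = - 1 * L2_inner \<Omega> f (div_plus \<Omega> \<tau> m)"
    unfolding L2_inner_scaleR_left .
  ultimately show ?thesis
    using Hm1_apply_diff[OF Y(6) X(1) g] by simp
qed

text \<open>
  This is Falk's argument for variational inequalities whose discrete cone need not be contained in the
  continuous one.  The residual \<open>\<langle>\<mu>\<^sub>h - \<lambda>\<^sub>h, u - g\<rangle>\<close> is split at \<open>\<lambda>\<close> and at an arbitrary
  \<open>\<mu>\<close> of the continuous cone, for which \<open>\<langle>\<lambda> - \<mu>, u - g\<rangle> \<le> 0\<close>.
\<close>

lemma VI_error_estimate:
  assumes C: "friedrichs_constant \<Omega> C" and \<beta>: "\<beta> \<ge> 1 + C\<^sup>2" and f: "f \<in> L2 \<Omega>" and g: "g \<in> H10 \<Omega>"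
    and sol: "VI_solution \<Omega> \<beta> f g (K1 \<Omega>) (u, \<sigma>, l)"
    and Kh: "K_h \<subseteq> U_space \<Omega>" and solh: "VI_solution \<Omega> \<beta> f g K_h (u_h, \<sigma>_h, l_h)"
    and vh: "(v_h, \<tau>_h, m_h) \<in> K_h" and v: "(v, \<tau>, m) \<in> K1 \<Omega>"
  shows "(U_norm \<Omega> ((u, \<sigma>, l) - (u_h, \<sigma>_h, l_h)))\<^sup>2 \<le> (16 * (2 * \<beta> + 5)\<^sup>2 + 8) *
    ((U_norm \<Omega> ((u, \<sigma>, l) - (v_h, \<tau>_h, m_h)))\<^sup>2 + \<bar>(m_h - l) (u - g)\<bar> + \<bar>(m - l_h) (u - g)\<bar>)"
proof -
  have "C\<^sup>2 \<ge> 0" by simp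
  then have \<beta>0: "\<beta> > 0" using \<beta> by linarith
  have x: "(u, \<sigma>, l) \<in> U_space \<Omega>" and y: "(v, \<tau>, m) \<in> U_space \<Omega>"
    and xh: "(u_h, \<sigma>_h, l_h) \<in> U_space \<Omega>" and yh: "(v_h, \<tau>_h, m_h) \<in> U_space \<Omega>"
    using sol v Kh solh vh by (auto simp: VI_solution_def K1_def)
  note first = VI_solution_first_order[OF \<beta>0 f sol]
  note residual = VI_solution_residual[OF f g x first]
  let ?e = "(u, \<sigma>, l) - (u_h, \<sigma>_h, l_h)"
  have e: "(u - u_h, \<sigma> - \<sigma>_h, l - l_h) \<in> U_space \<Omega>" by (rule U_space_diff(1)[OF x xh])
  have d: "(u - v_h, \<sigma> - \<tau>_h, l - m_h) \<in> U_space \<Omega>" by (rule U_space_diff(1)[OF x yh])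
  have h: "(v_h - u_h, \<tau>_h - \<sigma>_h, m_h - l_h) \<in> U_space \<Omega>" by (rule U_space_diff(1)[OF yh xh])
  define E D where "E = U_norm \<Omega> ((u, \<sigma>, l) - (u_h, \<sigma>_h, l_h))"
    and "D = U_norm \<Omega> ((u, \<sigma>, l) - (v_h, \<tau>_h, m_h))"
  define M where "M = 2 * \<beta> + 5"
  have sign: "0 \<le> (m - l) (u - g)"
  proof -
    have "H_form \<Omega> \<beta> f g ((v, \<tau>, m) - (u, \<sigma>, l)) \<le> c_form \<Omega> \<beta> (u, \<sigma>, l) ((v, \<tau>, m) - (u, \<sigma>, l))"
      using sol v unfolding VI_solution_def by blast
    then show ?thesis using residual[OF U_space_diff(1)[OF y x], of \<beta>] by (simp del: c_form.simps H_form.simps)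
  qed
  have "c_form \<Omega> \<beta> (u, \<sigma>, l) ((v_h, \<tau>_h, m_h) - (u_h, \<sigma>_h, l_h))
      - c_form \<Omega> \<beta> (u_h, \<sigma>_h, l_h) ((v_h, \<tau>_h, m_h) - (u_h, \<sigma>_h, l_h))
      \<le> c_form \<Omega> \<beta> (u, \<sigma>, l) ((v_h, \<tau>_h, m_h) - (u_h, \<sigma>_h, l_h))
      - H_form \<Omega> \<beta> f g ((v_h, \<tau>_h, m_h) - (u_h, \<sigma>_h, l_h))"
    using solh vh unfolding VI_solution_def by force
  also have "\<dots> = (m_h - l_h) (u - g)"
    using residual[OF h, of \<beta>] by (simp del: c_form.simps H_form.simps)
  also have "\<dots> = (m_h - l) (u - g) - (m - l) (u - g) + (m - l_h) (u - g)" by simp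
  also have "\<dots> \<le> \<bar>(m_h - l) (u - g)\<bar> + \<bar>(m - l_h) (u - g)\<bar>" using sign by linarith
  finally have consistency: "c_form \<Omega> \<beta> ?e ((v_h, \<tau>_h, m_h) - (u_h, \<sigma>_h, l_h))
      \<le> \<bar>(m_h - l) (u - g)\<bar> + \<bar>(m - l_h) (u - g)\<bar>"
    using c_form_diff_left[OF x xh h, of \<beta>] by (simp del: c_form.simps)
  have "E\<^sup>2 / 4 \<le> c_form \<Omega> \<beta> ?e ?e"
    using c_form_coercive[OF C \<beta> e] by (simp add: E_def del: c_form.simps U_norm.simps)
  also have "\<dots> = c_form \<Omega> \<beta> ?e ((u, \<sigma>, l) - (v_h, \<tau>_h, m_h)) + c_form \<Omega> \<beta> ?e ((v_h, \<tau>_h, m_h) - (u_h, \<sigma>_h, l_h))"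
    using c_form_diff_right[OF x xh e, of \<beta>] c_form_diff_right[OF x yh e, of \<beta>] c_form_diff_right[OF yh xh e, of \<beta>]
    by (simp del: c_form.simps)
  also have "c_form \<Omega> \<beta> ?e ((u, \<sigma>, l) - (v_h, \<tau>_h, m_h)) \<le> M * (E * D)"
    using c_form_bounded[OF C \<beta> e d] by (simp add: E_def D_def M_def del: c_form.simps U_norm.simps)
  finally have "E\<^sup>2 / 4 \<le> M * (E * D) + (\<bar>(m_h - l) (u - g)\<bar> + \<bar>(m - l_h) (u - g)\<bar>)"
    using consistency by linarith
  \<comment> \<open>Young's inequality, with the weight that absorbs half of \<open>E\<^sup>2 / 4\<close> on the left.\<close>
  moreover have "0 \<le> (E - 4 * M * D)\<^sup>2" by simp
  then have "M * (E * D) \<le> E\<^sup>2 / 8 + 2 * (M\<^sup>2 * D\<^sup>2)"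
    by (simp add: power2_diff power_mult_distrib mult_ac)
  moreover have "0 \<le> M\<^sup>2 * \<bar>(m_h - l) (u - g)\<bar>" "0 \<le> M\<^sup>2 * \<bar>(m - l_h) (u - g)\<bar>"
    "0 \<le> D\<^sup>2" "0 \<le> E\<^sup>2" "0 \<le> M\<^sup>2 * D\<^sup>2" by simp_all
  ultimately have "E\<^sup>2 \<le> (16 * M\<^sup>2 + 8) * (D\<^sup>2 + \<bar>(m_h - l) (u - g)\<bar> + \<bar>(m - l_h) (u - g)\<bar>)"
    unfolding distrib_left distrib_right by linarith
  then show ?thesis unfolding E_def D_def M_def .
qed

end

lemma le_cINF_add_cINF:
  fixes A :: "'a \<Rightarrow> real" and B :: "'b \<Rightarrow> real"
  assumes "C > 0" "I \<noteq> {}" "J \<noteq> {}"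
    and le: "\<And>i j. i \<in> I \<Longrightarrow> j \<in> J \<Longrightarrow> X \<le> C * (A i + B j)"
  shows "X \<le> C * ((INF i\<in>I. A i) + (INF j\<in>J. B j))"
proof -
  have "X / C - B j \<le> (INF i\<in>I. A i)" if "j \<in> J" for j
    using assms(1,2) le[OF _ that] by (intro cINF_greatest) (auto simp: field_simps)
  then have "X / C - (INF i\<in>I. A i) \<le> (INF j\<in>J. B j)"
    using assms(3) by (intro cINF_greatest) (auto simp: algebra_simps)
  with assms(1) show ?thesis by (simp add: field_simps)
qed

theorem theorem10:
  fixes \<Omega> :: "(real ^ 'n) set" and \<beta> :: real
  assumes "CARD('n) \<in> {2, 3}"
    and "polyhedral_lipschitz_domain \<Omega>"
  shows "\<exists>C_opt>0. \<forall>C_F. friedrichs_constant \<Omega> C_F \<longrightarrow> \<beta> \<ge> 1 + C_F\<^sup>2 \<longrightarrow>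
    (\<forall>f\<in>L2 \<Omega>. \<forall>g\<in>H10 \<Omega>. \<forall>u \<sigma> l K_h u_h \<sigma>_h l_h.
       VI_solution \<Omega> \<beta> f g (K1 \<Omega>) (u, \<sigma>, l) \<longrightarrow>
       K_h \<subseteq> U_space \<Omega> \<longrightarrow> K_h \<noteq> {} \<longrightarrow> convex K_h \<longrightarrow> closed_in_U \<Omega> K_h \<longrightarrow>
       VI_solution \<Omega> \<beta> f g K_h (u_h, \<sigma>_h, l_h) \<longrightarrow>
       (U_norm \<Omega> ((u, \<sigma>, l) - (u_h, \<sigma>_h, l_h)))\<^sup>2 \<le>
         C_opt *
           ((INF (v_h, \<tau>_h, m_h)\<in>K_h.
               (U_norm \<Omega> ((u, \<sigma>, l) - (v_h, \<tau>_h, m_h)))\<^sup>2 + \<bar>(m_h - l) (u - g)\<bar>) +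
            (INF (v, \<tau>, m)\<in>K1 \<Omega>. \<bar>(m - l_h) (u - g)\<bar>)))"
proof -
  interpret bounded_open \<Omega>
    using assms(2) by unfold_locales (auto simp: polyhedral_lipschitz_domain_def)
  have pos: "0 < 16 * (2 * \<beta> + 5)\<^sup>2 + 8"
    by (intro add_nonneg_pos) auto
  show ?thesis
  proof (intro exI[of _ "16 * (2 * \<beta> + 5)\<^sup>2 + 8"] conjI allI impI ballI pos le_cINF_add_cINF)
    fix C_F f g u \<sigma> l K_h u_h \<sigma>_h l_h
    assume "VI_solution \<Omega> \<beta> f g (K1 \<Omega>) (u, \<sigma>, l)"
    then show "K1 \<Omega> \<noteq> {}" by (auto simp: VI_solution_def)
  next
    fix C_F f g u \<sigma> l K_h u_h \<sigma>_h l_h and i j :: "'n triple"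
    assume C: "friedrichs_constant \<Omega> C_F" "1 + C_F\<^sup>2 \<le> \<beta>" and fg: "f \<in> L2 \<Omega>" "g \<in> H10 \<Omega>"
      and sol: "VI_solution \<Omega> \<beta> f g (K1 \<Omega>) (u, \<sigma>, l)" "K_h \<subseteq> U_space \<Omega>"
        "VI_solution \<Omega> \<beta> f g K_h (u_h, \<sigma>_h, l_h)"
      and ij: "i \<in> K_h" "j \<in> K1 \<Omega>"
    obtain v_h \<tau>_h m_h v \<tau> m where eq: "i = (v_h, \<tau>_h, m_h)" "j = (v, \<tau>, m)"
      by (metis prod_cases3)
    show "(U_norm \<Omega> ((u, \<sigma>, l) - (u_h, \<sigma>_h, l_h)))\<^sup>2 \<le> (16 * (2 * \<beta> + 5)\<^sup>2 + 8) *
      ((case i of (v_h, \<tau>_h, m_h) \<Rightarrow>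
          (U_norm \<Omega> ((u, \<sigma>, l) - (v_h, \<tau>_h, m_h)))\<^sup>2 + \<bar>(m_h - l) (u - g)\<bar>) +
       (case j of (v, \<tau>, m) \<Rightarrow> \<bar>(m - l_h) (u - g)\<bar>))"
      using VI_error_estimate[OF C fg sol ij[unfolded eq]] unfolding eq prod.case .
  qed
qed

end
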